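(* Every minimal surface of general type in $\mathbb R^4$ satisfying $\gamma_1=0$ locally admits canonical parameters, i.e. semi-canonical parameters $(u,v)$ with $$E=1,\qquad F=0,\qquad G=\frac{1}{\sqrt{|\mu^2-\nu^2|}} .$$
   Context: $\mathbb R^4$ carries the standard metric $g=\langle\cdot,\cdot\rangle$ and flat connection $\nabla'$; everything is smooth and local. For a regular surface $M^2: z=z(u,v)$ let $E,F,G$ be the first fundamental form coefficients, $\sigma$ the second fundamental form, $K$ the Gauss curvature, and $\varkappa$ the curvature of the normal connection, $\varkappa=g(R^\perp(x,y)n_2,n_1)$ for a positively oriented orthonormal frame $(x,y,n_1,n_2)$ with $x,y$ tangent. Minimal means $\sigma(x,x)+\sigma(y,y)=0$ for orthonormal tangent $x,y$. A minimal surface is of general type if $K^2-\varkappa^2>0$ and $\varkappa\neq0$ everywhere. The ellipse of curvature at $p$ is $\{\sigma(v,v): v\in T_pM^2,\ |v|=1\}$; a tangent line is canonical if it is collinear with an axis of this ellipse. The geometric frame is a positively oriented orthonormal frame $\{x,y,n_1,n_2\}$ with $x,y$ canonical tangent fields and $n_1,n_2$ normal, satisfying $\nabla'_xx=\gamma_1y+\nu n_1$, $\nabla'_xy=-\gamma_1x+\mu n_2$, $\nabla'_yx=-\gamma_2y+\mu n_2$, $\nabla'_yy=\gamma_2x-\nu n_1$, $\nabla'_xn_1=-\nu x+\beta_1n_2$, $\nabla'_yn_1=\nu y+\beta_2n_2$, $\nabla'_xn_2=-\mu y-\beta_1n_1$, $\nabla'_yn_2=-\mu x-\beta_2n_1$,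 with $\mu>0$, $\nu\ne0$, $\mu^2\ne\nu^2$; the functions $\nu,\mu,\gamma_1,\gamma_2,\beta_1,\beta_2$ are the invariants of $M^2$. Parameters $(u,v)$ are semi-canonical if the parametric lines are integral curves of the canonical tangents, with $F=0$, $x=z_u/\sqrt E$, $y=z_v/\sqrt G$; then $\gamma_1=-y(\ln\sqrt E)$, $\gamma_2=-x(\ln\sqrt G)$. *)

theory Defs
  imports "HOL-Analysis.Analysis"
begin

type_synonym param = "real \<times> real"
type_synonym pt4 = "real ^ 4"

definition pdu :: "(param \<Rightarrow> 'a::real_normed_vector) \<Rightarrow> param \<Rightarrow> 'a" where
  "pdu f p = vector_derivative (\<lambda>s. f (s, snd p)) (at (fst p))"

definition pdv :: "(param \<Rightarrow> 'a::real_normed_vector) \<Rightarrow> param \<Rightarrow> 'a" where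
  "pdv f p = vector_derivative (\<lambda>t. f (fst p, t)) (at (snd p))"

fun pds :: "bool list \<Rightarrow> (param \<Rightarrow> 'a::real_normed_vector) \<Rightarrow> param \<Rightarrow> 'a" where
  "pds [] f = f"
| "pds (b # bs) f = (if b then pdu (pds bs f) else pdv (pds bs f))"

definition smooth_on_pl :: "param set \<Rightarrow> (param \<Rightarrow> 'a::real_normed_vector) \<Rightarrow> bool" where
  "smooth_on_pl U f \<longleftrightarrow>
     (\<forall>bs. continuous_on U (pds bs f) \<and>
        (\<forall>p\<in>U. (\<lambda>s. pds bs f (s, snd p)) differentiable (at (fst p)) \<and>
               (\<lambda>t. pds bs f (fst p, t)) differentiable (at (snd p))))"

definition EE :: "(param \<Rightarrow> pt4) \<Rightarrow> param \<Rightarrow> real" where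
  "EE z p = inner (pdu z p) (pdu z p)"
definition FF :: "(param \<Rightarrow> pt4) \<Rightarrow> param \<Rightarrow> real" where
  "FF z p = inner (pdu z p) (pdv z p)"
definition GG :: "(param \<Rightarrow> pt4) \<Rightarrow> param \<Rightarrow> real" where
  "GG z p = inner (pdv z p) (pdv z p)"

definition regular_surface :: "param set \<Rightarrow> (param \<Rightarrow> pt4) \<Rightarrow> bool" where
  "regular_surface U z \<longleftrightarrow> open U \<and> smooth_on_pl U z \<and>
     (\<forall>p\<in>U. EE z p * GG z p - (FF z p)^2 > 0)"

definition tplane :: "(param \<Rightarrow> pt4) \<Rightarrow> param \<Rightarrow> pt4 set" where
  "tplane z p = span {pdu z p, pdv z p}"

definition tanproj :: "(param \<Rightarrow> pt4) \<Rightarrow> param \<Rightarrow> pt4 \<Rightarrow> pt4" where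
  "tanproj z p w = (THE t. t \<in> tplane z p \<and> (\<forall>s\<in>tplane z p. inner (w - t) s = 0))"

definition nrmproj :: "(param \<Rightarrow> pt4) \<Rightarrow> param \<Rightarrow> pt4 \<Rightarrow> pt4" where
  "nrmproj z p w = w - tanproj z p w"

definition tcoords :: "(param \<Rightarrow> pt4) \<Rightarrow> param \<Rightarrow> pt4 \<Rightarrow> real \<times> real" where
  "tcoords z p v = (THE ab. v = fst ab *\<^sub>R pdu z p + snd ab *\<^sub>R pdv z p)"

definition dD :: "(param \<Rightarrow> pt4) \<Rightarrow> (param \<Rightarrow> pt4) \<Rightarrow> (param \<Rightarrow> pt4) \<Rightarrow> param \<Rightarrow> pt4" where
  "dD z X W p = fst (tcoords z p (X p)) *\<^sub>R pdu W p + snd (tcoords z p (X p)) *\<^sub>R pdv W p"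

definition sff :: "(param \<Rightarrow> pt4) \<Rightarrow> param \<Rightarrow> pt4 \<Rightarrow> pt4 \<Rightarrow> pt4" where
  "sff z p v w = (let (a, b) = tcoords z p v; (c, d) = tcoords z p w in
     nrmproj z p ((a * c) *\<^sub>R pdu (pdu z) p + (a * d + b * c) *\<^sub>R pdv (pdu z) p
                  + (b * d) *\<^sub>R pdv (pdv z) p))"

definition minimal_surface :: "param set \<Rightarrow> (param \<Rightarrow> pt4) \<Rightarrow> bool" where
  "minimal_surface U z \<longleftrightarrow>
     (\<forall>p\<in>U. \<forall>v w. v \<in> tplane z p \<and> w \<in> tplane z p \<and> norm v = 1 \<and> norm w = 1 \<and> inner v w = 0
        \<longrightarrow> sff z p v v + sff z p w w = 0)"

definition nabT :: "(param \<Rightarrow> pt4) \<Rightarrow> (param \<Rightarrow> pt4) \<Rightarrow> (param \<Rightarrow> pt4) \<Rightarrow> param \<Rightarrow> pt4" where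
  "nabT z X W p = tanproj z p (dD z X W p)"
definition nabN :: "(param \<Rightarrow> pt4) \<Rightarrow> (param \<Rightarrow> pt4) \<Rightarrow> (param \<Rightarrow> pt4) \<Rightarrow> param \<Rightarrow> pt4" where
  "nabN z X W p = nrmproj z p (dD z X W p)"

definition lbr :: "(param \<Rightarrow> pt4) \<Rightarrow> (param \<Rightarrow> pt4) \<Rightarrow> (param \<Rightarrow> pt4) \<Rightarrow> param \<Rightarrow> pt4" where
  "lbr z X Y p = dD z X Y p - dD z Y X p"

definition RT :: "(param \<Rightarrow> pt4) \<Rightarrow> (param \<Rightarrow> pt4) \<Rightarrow> (param \<Rightarrow> pt4) \<Rightarrow> (param \<Rightarrow> pt4) \<Rightarrow> param \<Rightarrow> pt4" where
  "RT z X Y W p = nabT z X (nabT z Y W) p - nabT z Y (nabT z X W) p - nabT z (lbr z X Y) W p"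

definition RN :: "(param \<Rightarrow> pt4) \<Rightarrow> (param \<Rightarrow> pt4) \<Rightarrow> (param \<Rightarrow> pt4) \<Rightarrow> (param \<Rightarrow> pt4) \<Rightarrow> param \<Rightarrow> pt4" where
  "RN z X Y W p = nabN z X (nabN z Y W) p - nabN z Y (nabN z X W) p - nabN z (lbr z X Y) W p"

definition gauss_curv :: "(param \<Rightarrow> pt4) \<Rightarrow> param \<Rightarrow> real" where
  "gauss_curv z p = inner (RT z (pdu z) (pdv z) (pdv z) p) (pdu z p)
                     / (EE z p * GG z p - (FF z p)^2)"

definition adapted_frame_at ::
  "(param \<Rightarrow> pt4) \<Rightarrow> param \<Rightarrow> pt4 \<Rightarrow> pt4 \<Rightarrow> pt4 \<Rightarrow> pt4 \<Rightarrow> bool" where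
  "adapted_frame_at z p x y n1 n2 \<longleftrightarrow>
     x \<in> tplane z p \<and> y \<in> tplane z p \<and>
     (\<forall>s\<in>tplane z p. inner n1 s = 0 \<and> inner n2 s = 0) \<and>
     inner x x = 1 \<and> inner y y = 1 \<and> inner n1 n1 = 1 \<and> inner n2 n2 = 1 \<and>
     inner x y = 0 \<and> inner x n1 = 0 \<and> inner x n2 = 0 \<and>
     inner y n1 = 0 \<and> inner y n2 = 0 \<and> inner n1 n2 = 0 \<and>
     det (vector [x, y, n1, n2] :: real ^ 4 ^ 4) > 0"

text \<open>Curvature of the normal connection, varkappa = g(R^perp(x,y) n2, n1), computed in a
  (smooth, positively oriented, orthonormal, adapted) frame (x,y,n1,n2).\<close>
definition normal_curv :: "(param \<Rightarrow> pt4) \<Rightarrow> (param \<Rightarrow> pt4) \<Rightarrow> (param \<Rightarrow> pt4)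
    \<Rightarrow> (param \<Rightarrow> pt4) \<Rightarrow> (param \<Rightarrow> pt4) \<Rightarrow> param \<Rightarrow> real" where
  "normal_curv z x y n1 n2 p = inner (RN z x y n2 p) (n1 p)"

definition adapted_frame :: "param set \<Rightarrow> (param \<Rightarrow> pt4) \<Rightarrow> (param \<Rightarrow> pt4) \<Rightarrow> (param \<Rightarrow> pt4)
    \<Rightarrow> (param \<Rightarrow> pt4) \<Rightarrow> (param \<Rightarrow> pt4) \<Rightarrow> bool" where
  "adapted_frame U z x y n1 n2 \<longleftrightarrow>
     smooth_on_pl U x \<and> smooth_on_pl U y \<and> smooth_on_pl U n1 \<and> smooth_on_pl U n2 \<and>
     (\<forall>p\<in>U. adapted_frame_at z p (x p) (y p) (n1 p) (n2 p))"

definition minimal_general_type :: "param set \<Rightarrow> (param \<Rightarrow> pt4) \<Rightarrow> (param \<Rightarrow> pt4)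
    \<Rightarrow> (param \<Rightarrow> pt4) \<Rightarrow> (param \<Rightarrow> pt4) \<Rightarrow> (param \<Rightarrow> pt4) \<Rightarrow> bool" where
  "minimal_general_type U z x y n1 n2 \<longleftrightarrow>
     regular_surface U z \<and> minimal_surface U z \<and> adapted_frame U z x y n1 n2 \<and>
     (\<forall>p\<in>U. (gauss_curv z p)^2 - (normal_curv z x y n1 n2 p)^2 > 0 \<and>
             normal_curv z x y n1 n2 p \<noteq> 0)"

text \<open>A unit tangent vector v spans a canonical tangent line iff sigma(v,v) is a vertex of
  the ellipse of curvature, i.e. lies on one of its axes (the ellipse is centred at the
  mean curvature vector, which is 0 for minimal surfaces; vertices are the points at
  extremal distance from the centre).\<close>
definition canonical_dir :: "(param \<Rightarrow> pt4) \<Rightarrow> param \<Rightarrow> pt4 \<Rightarrow> bool" where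
  "canonical_dir z p v \<longleftrightarrow> v \<in> tplane z p \<and> norm v = 1 \<and>
     ((\<forall>w. w \<in> tplane z p \<and> norm w = 1 \<longrightarrow> norm (sff z p w w) \<le> norm (sff z p v v)) \<or>
      (\<forall>w. w \<in> tplane z p \<and> norm w = 1 \<longrightarrow> norm (sff z p v v) \<le> norm (sff z p w w)))"

definition geometric_frame :: "param set \<Rightarrow> (param \<Rightarrow> pt4)
    \<Rightarrow> (param \<Rightarrow> pt4) \<Rightarrow> (param \<Rightarrow> pt4) \<Rightarrow> (param \<Rightarrow> pt4) \<Rightarrow> (param \<Rightarrow> pt4)
    \<Rightarrow> (param \<Rightarrow> real) \<Rightarrow> (param \<Rightarrow> real) \<Rightarrow> (param \<Rightarrow> real) \<Rightarrow> (param \<Rightarrow> real)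
    \<Rightarrow> (param \<Rightarrow> real) \<Rightarrow> (param \<Rightarrow> real) \<Rightarrow> bool" where
  "geometric_frame U z x y n1 n2 \<nu> \<mu> \<gamma>\<^sub>1 \<gamma>\<^sub>2 \<beta>\<^sub>1 \<beta>\<^sub>2 \<longleftrightarrow>
     adapted_frame U z x y n1 n2 \<and>
     (\<forall>p\<in>U.
        canonical_dir z p (x p) \<and> canonical_dir z p (y p) \<and>
        dD z x x p = \<gamma>\<^sub>1 p *\<^sub>R y p + \<nu> p *\<^sub>R n1 p \<and>
        dD z x y p = - \<gamma>\<^sub>1 p *\<^sub>R x p + \<mu> p *\<^sub>R n2 p \<and>
        dD z y x p = - \<gamma>\<^sub>2 p *\<^sub>R y p + \<mu> p *\<^sub>R n2 p \<and>
        dD z y y p = \<gamma>\<^sub>2 p *\<^sub>R x p - \<nu> p *\<^sub>R n1 p \<and>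
        dD z x n1 p = - \<nu> p *\<^sub>R x p + \<beta>\<^sub>1 p *\<^sub>R n2 p \<and>
        dD z y n1 p = \<nu> p *\<^sub>R y p + \<beta>\<^sub>2 p *\<^sub>R n2 p \<and>
        dD z x n2 p = - \<mu> p *\<^sub>R y p - \<beta>\<^sub>1 p *\<^sub>R n1 p \<and>
        dD z y n2 p = - \<mu> p *\<^sub>R x p - \<beta>\<^sub>2 p *\<^sub>R n1 p \<and>
        \<mu> p > 0 \<and> \<nu> p \<noteq> 0 \<and> (\<mu> p)^2 \<noteq> (\<nu> p)^2)"

definition diffeo_pl :: "param set \<Rightarrow> param set \<Rightarrow> (param \<Rightarrow> param) \<Rightarrow> bool" where
  "diffeo_pl W V \<phi> \<longleftrightarrow> open W \<and> open V \<and> \<phi> ` W = V \<and> smooth_on_pl W \<phi> \<and>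
     (\<exists>\<psi>. smooth_on_pl V \<psi> \<and> \<psi> ` V = W \<and> (\<forall>q\<in>W. \<psi> (\<phi> q) = q) \<and> (\<forall>p\<in>V. \<phi> (\<psi> p) = p))"

text \<open>Semi-canonical parameters for the surface w (with respect to the canonical
  tangent fields X, Y given along the new parameters).\<close>
definition semi_canonical :: "param set \<Rightarrow> (param \<Rightarrow> pt4) \<Rightarrow> (param \<Rightarrow> pt4) \<Rightarrow> (param \<Rightarrow> pt4) \<Rightarrow> bool" where
  "semi_canonical W w X Y \<longleftrightarrow>
     (\<forall>q\<in>W. FF w q = 0 \<and> X q = (1 / sqrt (EE w q)) *\<^sub>R pdu w q \<and>
             Y q = (1 / sqrt (GG w q)) *\<^sub>R pdv w q)"

end

theory Submission
  imports Defs
begin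

text \<open>
  Let $h = |\mu^2 - \nu^2|^{1/4}$ (the function \<open>g\<close> below, written
  $((\mu^2 - \nu^2)^2)^{1/8}$ so that no absolute value is differentiated).
  When $\gamma_1 = 0$, the coframe
  $\theta_1 = \langle x, dz\rangle$, $\theta_2 = h\,\langle y, dz\rangle$ is closed: for
  $\theta_1$ this is $\gamma_1 = 0$, and for $\theta_2$ it is $x(\ln h) = \gamma_2$, which follows from
  the Codazzi equations for $x(\mu)$ and $x(\nu)$. Potentials of $\theta_1$ and $\theta_2$ are the
  new coordinates $(u, v)$; in them the coordinate fields are $x$ and $y/h$, so that $E = 1$, $F = 0$
  and $G = 1/h^2$.
\<close>

subsection \<open>Smooth functions of two variables\<close>

text \<open>The fourth root comes from the Codazzi equations:
  \<open>x(\<mu>) = 2 \<gamma>\<^sub>2 \<mu> + \<beta>\<^sub>2 \<nu>\<close> and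
  \<open>x(\<nu>) = 2 \<gamma>\<^sub>2 \<nu> + \<beta>\<^sub>2 \<mu>\<close>. In the derivative of
  \<open>\<mu>^2 - \<nu>^2\<close> along \<open>x\<close> the \<open>\<beta>\<^sub>2\<close> terms
  cancel, leaving \<open>4 \<gamma>\<^sub>2 (\<mu>^2 - \<nu>^2)\<close>; the logarithm of the fourth
  root therefore has derivative exactly \<open>\<gamma>\<^sub>2\<close>. Both exterior derivatives
  of the coframe and both Codazzi equations are instances of one identity: the mixed partials of a
  vector field agree, and this is paired with a vector of the frame. Two obstacles shape the text.
  Smoothness is given through iterated partials along coordinate lines, whereas the chain rule and
  the inverse function theorem need total derivatives, so a translation in both directions is
  required. The invariants are bare functions tied to the frame by pointwise equations, so the
  smoothness of \<open>\<mu>\<close> and \<open>\<nu>\<close> has to be recovered from that of the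
  frame.\<close>

definition has_partials :: "(param \<Rightarrow> 'a::real_normed_vector) \<Rightarrow> 'a \<Rightarrow> 'a \<Rightarrow> param \<Rightarrow> bool" where
  "has_partials f a b p \<longleftrightarrow> (f has_derivative (\<lambda>h. fst h *\<^sub>R a + snd h *\<^sub>R b)) (at p)"

text \<open>
  Demanding a total derivative with some $C^k$ partials, instead of the iterated partials of
  \<^const>\<open>pds\<close>, lets closure under products, powers and composition go through by
  induction on the order.
\<close>
primrec Ck :: "nat \<Rightarrow> param set \<Rightarrow> (param \<Rightarrow> 'a::real_normed_vector) \<Rightarrow> bool" where
  "Ck 0 U f = continuous_on U f"
| "Ck (Suc k) U f = (\<exists>fu fv. Ck k U fu \<and> Ck k U fv \<and> (\<forall>p\<in>U. has_partials f (fu p) (fv p) p))"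

section \<open>Total derivatives recorded by their two columns, and their calculus\<close>

lemma has_partials_pdu:
  assumes "has_partials f a b p"
  shows "((\<lambda>s. f (s, snd p)) has_vector_derivative a) (at (fst p))" "pdu f p = a"
proof -
  have "((f \<circ> (\<lambda>s. (s, snd p))) has_derivative (\<lambda>h. fst h *\<^sub>R a + snd h *\<^sub>R b) \<circ> (\<lambda>h. (h, 0))) (at (fst p))"
    by (rule diff_chain_at)
      (use assms in \<open>auto simp: has_partials_def intro!: derivative_eq_intros\<close>)
  then show *: "((\<lambda>s. f (s, snd p)) has_vector_derivative a) (at (fst p))"
    by (simp add: has_vector_derivative_def o_def)
  show "pdu f p = a"
    unfolding pdu_def by (rule vector_derivative_at[OF *])
qed

lemma has_partials_pdv:
  assumes "has_partials f a b p"
  shows "((\<lambda>t. f (fst p, t)) has_vector_derivative b) (at (snd p))" "pdv f p = b"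
proof -
  have "((f \<circ> (\<lambda>s. (fst p, s))) has_derivative (\<lambda>h. fst h *\<^sub>R a + snd h *\<^sub>R b) \<circ> (\<lambda>h. (0, h))) (at (snd p))"
    by (rule diff_chain_at)
      (use assms in \<open>auto simp: has_partials_def intro!: derivative_eq_intros\<close>)
  then show *: "((\<lambda>t. f (fst p, t)) has_vector_derivative b) (at (snd p))"
    by (simp add: has_vector_derivative_def o_def)
  show "pdv f p = b"
    unfolding pdv_def by (rule vector_derivative_at[OF *])
qed

lemma has_partials_continuous_on:
  assumes "\<And>p. p \<in> U \<Longrightarrow> has_partials f (fu p) (fv p) p"
  shows "continuous_on U f"
  by (meson assms continuous_at_imp_continuous_on has_derivative_continuous has_partials_def)

lemma has_partials_transform:
  assumes "has_partials f a b p" "open U" "p \<in> U" "\<And>q. q \<in> U \<Longrightarrow> f q = g q"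
  shows "has_partials g a b p"
  using assms unfolding has_partials_def by (rule has_derivative_transform_within_open)

lemma has_partials_bilinear:
  assumes "bounded_bilinear B" "has_partials f a b p" "has_partials g c d p"
  shows "has_partials (\<lambda>q. B (f q) (g q)) (B a (g p) + B (f p) c) (B b (g p) + B (f p) d) p"
proof -
  interpret bounded_bilinear B by fact
  show ?thesis
    using FDERIV[OF assms(2,3)[unfolded has_partials_def]]
    unfolding has_partials_def
    by (rule has_derivative_eq_rhs) (auto simp: add_left add_right scaleR_left scaleR_right algebra_simps)
qed

lemmas has_partials_mult = has_partials_bilinear[OF bounded_bilinear_mult]
lemmas has_partials_inner = has_partials_bilinear[OF bounded_bilinear_inner]

lemma has_partials_add:
  "has_partials f a b p \<Longrightarrow> has_partials g c d p \<Longrightarrow> has_partials (\<lambda>q. f q + g q) (a + c) (b + d) p"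
  unfolding has_partials_def
  by (rule has_derivative_eq_rhs, erule (1) has_derivative_add) (simp add: algebra_simps)

lemma has_partials_linear:
  assumes "bounded_linear L" "has_partials f a b p"
  shows "has_partials (\<lambda>q. L (f q)) (L a) (L b) p"
proof -
  interpret bounded_linear L by fact
  show ?thesis
    using has_derivative[OF assms(2)[unfolded has_partials_def]]
    unfolding has_partials_def
    by (rule has_derivative_eq_rhs) (auto simp: add scaleR)
qed

lemma has_partials_Pair:
  "has_partials f a b p \<Longrightarrow> has_partials g c d p \<Longrightarrow> has_partials (\<lambda>q. (f q, g q)) (a, c) (b, d) p"
  unfolding has_partials_def
  by (rule has_derivative_eq_rhs, erule (1) has_derivative_Pair) auto

lemma has_partials_chain:
  assumes "has_partials f a b (\<phi> p)" "has_partials \<phi> c d p"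
  shows "has_partials (f \<circ> \<phi>) (fst c *\<^sub>R a + snd c *\<^sub>R b) (fst d *\<^sub>R a + snd d *\<^sub>R b) p"
  using diff_chain_at[OF assms(2,1)[unfolded has_partials_def]]
  unfolding has_partials_def
  by (rule has_derivative_eq_rhs) (auto simp: fun_eq_iff algebra_simps)

lemma has_partials_powr:
  fixes f :: "param \<Rightarrow> real"
  assumes "has_partials f a b p" "f p > 0"
  shows "has_partials (\<lambda>q. f q powr e) (e * f p powr (e - 1) * a) (e * f p powr (e - 1) * b) p"
proof -
  have "((\<lambda>t. t powr e) has_derivative (\<lambda>h. (e * f p powr (e - 1)) * h)) (at (f p))"
    using has_real_derivative_powr[of "f p" e] assms(2) unfolding has_field_derivative_def by simp
  from diff_chain_at[OF assms(1)[unfolded has_partials_def] this]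
  show ?thesis
    unfolding has_partials_def o_def
    by (rule has_derivative_eq_rhs) (auto simp: fun_eq_iff algebra_simps)
qed

text \<open>Continuity of one of the two partials is enough for a total derivative: the mean value
  estimate is applied along the v-direction only, and the u-direction contributes just its
  derivative at the point itself.\<close>

lemma has_partials_continuous_partials:
  fixes f :: "param \<Rightarrow> 'a::real_normed_vector"
  assumes "open U" "p \<in> U"
    and fu: "\<And>q. q \<in> U \<Longrightarrow> ((\<lambda>s. f (s, snd q)) has_vector_derivative fu q) (at (fst q))"
    and fv: "\<And>q. q \<in> U \<Longrightarrow> ((\<lambda>t. f (fst q, t)) has_vector_derivative fv q) (at (snd q))"
    and cont: "continuous_on U fv"
  shows "has_partials f (fu p) (fv p) p"
proof -
  obtain A B where AB: "open A" "open B" "p \<in> A \<times> B" "A \<times> B \<subseteq> U"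
    using assms(1,2) by (rule open_prod_elim)
  \<comment> \<open>The v-factor is shrunk to a ball because the mean value estimate runs over
    segments in it, hence needs a convex set.\<close>
  obtain e where e: "e > 0" "ball (snd p) e \<subseteq> B"
    using AB(2,3) openE[of B "snd p"] by (auto simp: mem_Times_iff)
  let ?B = "ball (snd p) e"
  have sub: "A \<times> ?B \<subseteq> U" and pin: "p \<in> A \<times> ?B" and op: "open (A \<times> ?B)"
    using AB e by (auto simp: mem_Times_iff intro: open_Times)
  let ?fy = "\<lambda>x y. blinfun_scaleR_left (fv (x, y))"
  have "((\<lambda>(x, y). f (x, y)) has_derivative
      (\<lambda>(tx, ty). tx *\<^sub>R fu p + blinfun_apply (?fy (fst p) (snd p)) ty)) (at (fst p, snd p) within A \<times> ?B)"
  proof (rule has_derivative_partialsI)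
    show "((\<lambda>x. f (x, snd p)) has_derivative (\<lambda>tx. tx *\<^sub>R fu p)) (at (fst p) within A)"
      using fu[OF assms(2)] by (simp add: has_vector_derivative_def has_derivative_at_withinI)
    show "((\<lambda>y. f (x, y)) has_derivative blinfun_apply (?fy x y)) (at y within ?B)"
      if "x \<in> A" "y \<in> ?B" for x y
    proof -
      have "(x, y) \<in> U" using that sub by blast
      from fv[OF this] show ?thesis
        unfolding has_vector_derivative_def blinfun_scaleR_left.rep_eq fst_conv snd_conv
        by (rule has_derivative_at_withinI)
    qed
    have "continuous_on (A \<times> ?B) (\<lambda>q. blinfun_scaleR_left (fv q))"
      by (rule bounded_linear.continuous_on[OF bounded_linear_blinfun_scaleR_left])
        (rule continuous_on_subset[OF cont sub])
    then show "continuous (at (fst p, snd p) within A \<times> ?B) (\<lambda>(x, y). ?fy x y)"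
      using pin by (auto simp: continuous_on_eq_continuous_within split_beta')
  qed (use e in auto)
  then have "(f has_derivative (\<lambda>(tx, ty). tx *\<^sub>R fu p + ty *\<^sub>R fv p)) (at p)"
    using at_within_open[OF pin op] by simp
  then show ?thesis
    by (simp add: has_partials_def split_beta')
qed

section \<open>Closure properties of the classes \<open>Ck\<close>\<close>

lemma Ck_SucI:
  assumes "Ck k U fu" "Ck k U fv" "\<And>p. p \<in> U \<Longrightarrow> has_partials f (fu p) (fv p) p"
  shows "Ck (Suc k) U f"
  using assms unfolding Ck.simps by blast

lemma Ck_SucE:
  assumes "Ck (Suc k) U f"
  obtains fu fv where "Ck k U fu" "Ck k U fv" "\<forall>p\<in>U. has_partials f (fu p) (fv p) p"
  using assms unfolding Ck.simps by blast

lemma Ck_cong: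
  assumes "open U" "Ck k U f" "\<And>p. p \<in> U \<Longrightarrow> f p = g p"
  shows "Ck k U g"
proof (cases k)
  case 0
  then show ?thesis using assms continuous_on_cong[of U U f g] by simp
next
  case (Suc m)
  with assms(2) obtain fu fv where f: "Ck m U fu" "Ck m U fv" "\<forall>p\<in>U. has_partials f (fu p) (fv p) p"
    using Ck_SucE by blast
  show ?thesis unfolding Suc
    by (rule Ck_SucI[OF f(1,2)])
      (rule has_partials_transform[OF f(3)[rule_format] assms(1) _ assms(3)])
qed

lemma Ck_subset: "Ck k U f \<Longrightarrow> V \<subseteq> U \<Longrightarrow> Ck k V f"
proof (induction k arbitrary: f)
  case 0 then show ?case using continuous_on_subset by auto
next
  case (Suc k)
  from Suc.prems(1) obtain fu fv where f: "Ck k U fu" "Ck k U fv"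
    "\<forall>p\<in>U. has_partials f (fu p) (fv p) p" by (rule Ck_SucE)
  show ?case
    by (rule Ck_SucI[OF Suc.IH[OF f(1)] Suc.IH[OF f(2)]]) (use f(3) Suc.prems(2) in auto)
qed

lemma Ck_continuous_on: "Ck k U f \<Longrightarrow> continuous_on U f"
  by (cases k) (auto intro: has_partials_continuous_on)

lemma Ck_Suc: "Ck (Suc k) U f \<Longrightarrow> Ck k U f"
proof (induction k arbitrary: f)
  case 0 then show ?case using Ck_continuous_on[of "Suc 0"] by auto
next
  case (Suc k)
  from Suc.prems(1) obtain fu fv where f: "Ck (Suc k) U fu" "Ck (Suc k) U fv"
    "\<forall>p\<in>U. has_partials f (fu p) (fv p) p" by (rule Ck_SucE)
  show ?case
    by (rule Ck_SucI[OF Suc.IH[OF f(1)] Suc.IH[OF f(2)] f(3)[rule_format]])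
qed

lemma Ck_const: "Ck k U (\<lambda>_. c)"
proof (induction k arbitrary: c)
  case (Suc k)
  have "has_partials (\<lambda>_. c) 0 0 p" for p :: param by (simp add: has_partials_def)
  then show ?case by (rule Ck_SucI[OF Suc.IH Suc.IH])
qed simp

lemma Ck_add: "Ck k U f \<Longrightarrow> Ck k U g \<Longrightarrow> Ck k U (\<lambda>p. f p + g p)"
proof (induction k arbitrary: f g)
  case 0 then show ?case by (simp add: continuous_on_add)
next
  case (Suc k)
  from Suc.prems(1) obtain fu fv where f: "Ck k U fu" "Ck k U fv"
    "\<forall>p\<in>U. has_partials f (fu p) (fv p) p" by (rule Ck_SucE)
  from Suc.prems(2) obtain gu gv where g: "Ck k U gu" "Ck k U gv"
    "\<forall>p\<in>U. has_partials g (gu p) (gv p) p" by (rule Ck_SucE)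
  show ?case
    by (rule Ck_SucI[OF Suc.IH[OF f(1) g(1)] Suc.IH[OF f(2) g(2)]])
      (rule has_partials_add[OF f(3)[rule_format] g(3)[rule_format]])
qed

lemma Ck_linear:
  assumes "bounded_linear L"
  shows "Ck k U f \<Longrightarrow> Ck k U (\<lambda>p. L (f p))"
proof (induction k arbitrary: f)
  case 0 then show ?case using assms by (simp add: bounded_linear.continuous_on)
next
  case (Suc k)
  from Suc.prems(1) obtain fu fv where f: "Ck k U fu" "Ck k U fv"
    "\<forall>p\<in>U. has_partials f (fu p) (fv p) p" by (rule Ck_SucE)
  show ?case
    by (rule Ck_SucI[OF Suc.IH[OF f(1)] Suc.IH[OF f(2)]])
      (rule has_partials_linear[OF assms f(3)[rule_format]])
qed

lemma Ck_bilinear: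
  assumes "bounded_bilinear B"
  shows "Ck k U f \<Longrightarrow> Ck k U g \<Longrightarrow> Ck k U (\<lambda>p. B (f p) (g p))"
proof (induction k arbitrary: f g)
  case 0 then show ?case using assms by (simp add: bounded_bilinear.continuous_on)
next
  case (Suc k)
  from Suc.prems(1) obtain fu fv where f: "Ck k U fu" "Ck k U fv"
    "\<forall>p\<in>U. has_partials f (fu p) (fv p) p" by (rule Ck_SucE)
  from Suc.prems(2) obtain gu gv where g: "Ck k U gu" "Ck k U gv"
    "\<forall>p\<in>U. has_partials g (gu p) (gv p) p" by (rule Ck_SucE)
  \<comment> \<open>Each Leibniz term keeps one factor undifferentiated; its order is lowered to
    \<open>k\<close> to match the differentiated one.\<close>
  note fg = Suc.prems[THEN Ck_Suc]
  show ?case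
    by (rule Ck_SucI[OF Ck_add[OF Suc.IH[OF f(1) fg(2)] Suc.IH[OF fg(1) g(1)]]
          Ck_add[OF Suc.IH[OF f(2) fg(2)] Suc.IH[OF fg(1) g(2)]]])
      (rule has_partials_bilinear[OF assms f(3)[rule_format] g(3)[rule_format]])
qed

lemmas Ck_mult = Ck_bilinear[OF bounded_bilinear_mult]
lemmas Ck_inner = Ck_bilinear[OF bounded_bilinear_inner]
lemmas Ck_scaleR = Ck_bilinear[OF bounded_bilinear_scaleR]

lemma Ck_minus: "Ck k U f \<Longrightarrow> Ck k U (\<lambda>p. - f p)"
  by (rule Ck_linear[OF bounded_linear_minus[OF bounded_linear_ident]])

lemma Ck_diff: "Ck k U f \<Longrightarrow> Ck k U g \<Longrightarrow> Ck k U (\<lambda>p. f p - g p)"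
  using Ck_add[OF _ Ck_minus, of k U f g] by simp

lemma Ck_Pair: "Ck k U f \<Longrightarrow> Ck k U g \<Longrightarrow> Ck k U (\<lambda>p. (f p, g p))"
proof (induction k arbitrary: f g)
  case 0 then show ?case by (simp add: continuous_on_Pair)
next
  case (Suc k)
  from Suc.prems(1) obtain fu fv where f: "Ck k U fu" "Ck k U fv"
    "\<forall>p\<in>U. has_partials f (fu p) (fv p) p" by (rule Ck_SucE)
  from Suc.prems(2) obtain gu gv where g: "Ck k U gu" "Ck k U gv"
    "\<forall>p\<in>U. has_partials g (gu p) (gv p) p" by (rule Ck_SucE)
  show ?case
    by (rule Ck_SucI[OF Suc.IH[OF f(1) g(1)] Suc.IH[OF f(2) g(2)]])
      (rule has_partials_Pair[OF f(3)[rule_format] g(3)[rule_format]])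
qed

text \<open>The induction ranges over all exponents at once, since differentiation replaces
  \<open>e\<close> by \<open>e - 1\<close>.\<close>

lemma Ck_powr:
  fixes f :: "param \<Rightarrow> real"
  assumes pos: "\<And>p. p \<in> U \<Longrightarrow> f p > 0"
  shows "Ck k U f \<Longrightarrow> Ck k U (\<lambda>p. f p powr e)"
proof (induction k arbitrary: e)
  case 0 then show ?case using pos
    by (auto intro!: continuous_on_powr) (metis less_irrefl)
next
  case (Suc k)
  from Suc.prems(1) obtain fu fv where f: "Ck k U fu" "Ck k U fv"
    "\<forall>p\<in>U. has_partials f (fu p) (fv p) p" by (rule Ck_SucE)
  have c: "Ck k U (\<lambda>p. e * f p powr (e - 1))"
    by (rule Ck_mult[OF Ck_const Suc.IH[OF Ck_Suc[OF Suc.prems]]])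
  show ?case
    by (rule Ck_SucI[OF Ck_mult[OF c f(1)] Ck_mult[OF c f(2)]])
      (rule has_partials_powr[OF f(3)[rule_format] pos])
qed

text \<open>The sign of \<open>f\<close> is not known, so the power rule is applied to the positive
  function \<open>f * f\<close>, and 1/f is written as f times its inverse.\<close>

lemma Ck_inverse:
  fixes f :: "param \<Rightarrow> real"
  assumes "open U" "Ck k U f" "\<And>p. p \<in> U \<Longrightarrow> f p \<noteq> 0"
  shows "Ck k U (\<lambda>p. 1 / f p)"
proof (rule Ck_cong[OF assms(1)])
  show "Ck k U (\<lambda>p. f p * (f p * f p) powr (-1))"
    using assms by (intro Ck_mult Ck_powr) (simp_all add: zero_less_mult_iff linorder_neq_iff[symmetric] disj_commute)
  show "f p * (f p * f p) powr (-1) = 1 / f p" if "p \<in> U" for p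
    using assms(3)[OF that] by (simp add: powr_minus_divide)
qed

lemma Ck_divide:
  fixes f g :: "param \<Rightarrow> real"
  assumes "open U" "Ck k U f" "Ck k U g" "\<And>p. p \<in> U \<Longrightarrow> g p \<noteq> 0"
  shows "Ck k U (\<lambda>p. f p / g p)"
  using Ck_mult[OF assms(2) Ck_inverse[OF assms(1,3,4)]] by simp

lemma Ck_compose:
  assumes "\<phi> ` W \<subseteq> V"
  shows "Ck k V f \<Longrightarrow> Ck k W \<phi> \<Longrightarrow> Ck k W (f \<circ> \<phi>)"
proof (induction k arbitrary: f)
  case 0 then show ?case using assms continuous_on_compose2[of V f W \<phi>] by (simp add: o_def)
next
  case (Suc k)
  from Suc.prems(1) obtain fu fv where f: "Ck k V fu" "Ck k V fv"
    "\<forall>p\<in>V. has_partials f (fu p) (fv p) p" by (rule Ck_SucE)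
  from Suc.prems(2) obtain c d where c: "Ck k W c" "Ck k W d"
    "\<forall>p\<in>W. has_partials \<phi> (c p) (d p) p" by (rule Ck_SucE)
  note cmp = Suc.IH[OF f(1) Ck_Suc[OF Suc.prems(2)]] Suc.IH[OF f(2) Ck_Suc[OF Suc.prems(2)]]
  let ?g = "\<lambda>e p. fst (e p) *\<^sub>R (fu \<circ> \<phi>) p + snd (e p) *\<^sub>R (fv \<circ> \<phi>) p"
  have "Ck k W (?g c)" "Ck k W (?g d)"
    by (intro Ck_add Ck_scaleR cmp Ck_linear[OF bounded_linear_fst] Ck_linear[OF bounded_linear_snd] c)+
  then show ?case
  proof (rule Ck_SucI)
    show "has_partials (f \<circ> \<phi>) (?g c p) (?g d p) p" if "p \<in> W" for p
      unfolding o_def[of fu] o_def[of fv] using assms that by (intro has_partials_chain f(3)[rule_format] c(3)[rule_format]) auto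
  qed
qed

section \<open>On open sets, \<open>smooth_on_pl\<close> means \<open>Ck\<close> for every
  order\<close>

lemma smooth_on_pl_pd: "smooth_on_pl U f \<Longrightarrow> smooth_on_pl U (pdu f) \<and> smooth_on_pl U (pdv f)"
proof -
  assume s: "smooth_on_pl U f"
  \<comment> \<open>The last entry of the list is the derivative taken first, so differentiating
    \<open>f\<close> beforehand appends an entry at the end.\<close>
  have *: "pds bs (pds [b] f) = pds (bs @ [b]) f" for bs b
    by (induction bs) auto
  have "smooth_on_pl U (pds [b] f)" for b
    using s unfolding smooth_on_pl_def * by blast
  from this[of True] this[of False] show ?thesis by simp
qed

lemma smooth_on_pl_has_partials:
  assumes "open U" "smooth_on_pl U f" "p \<in> U"
  shows "has_partials f (pdu f p) (pdv f p) p"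
proof (rule has_partials_continuous_partials[OF assms(1,3)])
  note s = assms(2)[unfolded smooth_on_pl_def, rule_format]
  show "continuous_on U (pdv f)" using s[of "[False]"] by simp
  show "((\<lambda>s. f (s, snd q)) has_vector_derivative pdu f q) (at (fst q))" if "q \<in> U" for q
    unfolding pdu_def vector_derivative_works[symmetric] using s[of "[]"] that by simp
  show "((\<lambda>s. f (fst q, s)) has_vector_derivative pdv f q) (at (snd q))" if "q \<in> U" for q
    unfolding pdv_def vector_derivative_works[symmetric] using s[of "[]"] that by simp
qed

lemma smooth_on_pl_Ck: "open U \<Longrightarrow> smooth_on_pl U f \<Longrightarrow> Ck k U f"
proof (induction k arbitrary: f)
  case 0 then show ?case
    unfolding smooth_on_pl_def by (auto dest: spec[of _ "[]"])
next
  case (Suc k)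
  note pd = smooth_on_pl_pd[OF Suc.prems(2)]
  show ?case
    by (rule Ck_SucI[OF Suc.IH Suc.IH, OF Suc.prems(1) conjunct1[OF pd] Suc.prems(1) conjunct2[OF pd]])
      (rule smooth_on_pl_has_partials[OF Suc.prems])
qed

text \<open>The partials inside \<open>Ck\<close> are only asserted to exist. On \<open>U\<close>
  they are forced to be \<open>pdu g\<close> and \<open>pdv g\<close>; off \<open>U\<close> they are
  arbitrary, so the class is transferred by agreement on \<open>U\<close>.\<close>

lemma Ck_pdu_pdv:
  assumes "open U" "Ck (Suc k) U g"
  shows "Ck k U (pdu g)" "Ck k U (pdv g)"
proof -
  from assms(2) obtain gu gv where g: "Ck k U gu" "Ck k U gv" "\<forall>p\<in>U. has_partials g (gu p) (gv p) p"
    by (rule Ck_SucE)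
  show "Ck k U (pdu g)"
    by (rule Ck_cong[OF assms(1) g(1)]) (simp add: has_partials_pdu(2)[OF g(3)[rule_format]])
  show "Ck k U (pdv g)"
    by (rule Ck_cong[OF assms(1) g(2)]) (simp add: has_partials_pdv(2)[OF g(3)[rule_format]])
qed

lemma Ck_smooth_on_pl:
  assumes "open U" "\<And>k. Ck k U f"
  shows "smooth_on_pl U f"
  unfolding smooth_on_pl_def
proof (intro allI conjI ballI)
  fix bs
  \<comment> \<open>The order stays arbitrary because every entry of the list costs one.\<close>
  have all: "Ck k U (pds bs f)" for k
    by (induction bs arbitrary: k) (auto simp: assms Ck_pdu_pdv)
  then show "continuous_on U (pds bs f)" by (rule Ck_continuous_on)
  fix p assume p: "p \<in> U"
  obtain gu gv where "\<forall>p\<in>U. has_partials (pds bs f) (gu p) (gv p) p"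
    by (rule Ck_SucE[OF all])
  note hp = this[rule_format, OF p]
  show "(\<lambda>s. pds bs f (s, snd p)) differentiable (at (fst p))"
    by (rule differentiableI_vector[OF has_partials_pdu(1)[OF hp]])
  show "(\<lambda>t. pds bs f (fst p, t)) differentiable (at (snd p))"
    by (rule differentiableI_vector[OF has_partials_pdv(1)[OF hp]])
qed

lemma Ck_has_partials:
  assumes "Ck (Suc k) U f" "p \<in> U"
  shows "has_partials f (pdu f p) (pdv f p) p"
proof -
  obtain fu fv where "\<forall>p\<in>U. has_partials f (fu p) (fv p) p"
    by (rule Ck_SucE[OF assms(1)])
  then have "has_partials f (fu p) (fv p) p" using assms(2) by blast
  with has_partials_pdu(2)[OF this] has_partials_pdv(2)[OF this] show ?thesis by simp
qed

lemma pd_cong: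
  assumes "open U" "p \<in> U" "Ck 1 U f" "\<And>q. q \<in> U \<Longrightarrow> f q = g q"
  shows "pdu f p = pdu g p" "pdv f p = pdv g p"
proof -
  have "has_partials f (pdu f p) (pdv f p) p"
    using Ck_has_partials[of 0] assms by simp
  from has_partials_transform[OF this assms(1,2,4)]
  show "pdu f p = pdu g p" "pdv f p = pdv g p"
    using has_partials_pdu(2) has_partials_pdv(2) by metis+
qed

lemma pd_mult:
  fixes f g :: "param \<Rightarrow> real"
  assumes "Ck (Suc 0) U f" "Ck (Suc 0) U g" "p \<in> U"
  shows "pdu (\<lambda>q. f q * g q) p = pdu f p * g p + f p * pdu g p"
    "pdv (\<lambda>q. f q * g q) p = pdv f p * g p + f p * pdv g p"
  using has_partials_mult[OF Ck_has_partials[OF assms(1,3)] Ck_has_partials[OF assms(2,3)]]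
  by (rule has_partials_pdu has_partials_pdv)+

lemma pd_minus:
  assumes "Ck (Suc 0) U f" "p \<in> U"
  shows "pdu (\<lambda>q. - f q) p = - pdu f p" "pdv (\<lambda>q. - f q) p = - pdv f p"
  using has_partials_linear[OF bounded_linear_minus[OF bounded_linear_ident] Ck_has_partials[OF assms]]
  by (rule has_partials_pdu has_partials_pdv)+

subsection \<open>Mixed partials, closed forms and local inverses\<close>

lemma open_contains_rectangle:
  assumes "open U" "(p :: param) \<in> U"
  obtains a b c d where "a < fst p" "fst p < b" "c < snd p" "snd p < d" "{a..b} \<times> {c..d} \<subseteq> U"
proof -
  obtain A B where AB: "open A" "open B" "p \<in> A \<times> B" "A \<times> B \<subseteq> U"
    using assms by (rule open_prod_elim)
  obtain e where e: "e > 0" "cball (fst p) e \<subseteq> A"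
    using AB by (auto simp: open_contains_cball mem_Times_iff)
  obtain e' where e': "e' > 0" "cball (snd p) e' \<subseteq> B"
    using AB by (auto simp: open_contains_cball mem_Times_iff)
  show thesis
    using e e' AB(4) by (intro that[of "fst p - e" "fst p + e" "snd p - e'" "snd p + e'"]) (auto simp: cball_eq_atLeastAtMost)
qed

lemma has_vector_derivative_integral_param:
  fixes Q :: "param \<Rightarrow> 'a::banach"
  assumes Q: "\<And>p. p \<in> {a..b} \<times> {c..v} \<Longrightarrow> ((\<lambda>s. Q (s, snd p)) has_vector_derivative Qu p) (at (fst p))"
    and contQ: "continuous_on ({a..b} \<times> {c..v}) Q"
    and contQu: "continuous_on ({a..b} \<times> {c..v}) Qu"
    and u: "a < u" "u < b"
  shows "((\<lambda>u. integral {c..v} (\<lambda>t. Q (u, t))) has_vector_derivative integral {c..v} (\<lambda>t. Qu (u, t))) (at u)"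
proof -
  have "((\<lambda>u. integral (cbox c v) (\<lambda>t. Q (u, t))) has_vector_derivative integral (cbox c v) (\<lambda>t. Qu (u, t)))
     (at u within {a..b})"
  proof (rule leibniz_rule_vector_derivative[where fx = "\<lambda>u t. Qu (u, t)"])
    show "((\<lambda>x. Q (x, t)) has_vector_derivative Qu (x, t)) (at x within {a..b})"
      if "x \<in> {a..b}" "t \<in> cbox c v" for x t
      using Q[of "(x, t)"] that by (auto intro: has_vector_derivative_at_within)
    show "(\<lambda>t. Q (x, t)) integrable_on cbox c v" if "x \<in> {a..b}" for x
      using that by (intro integrable_continuous continuous_on_compose2[OF contQ]) (auto intro!: continuous_intros)
    show "continuous_on ({a..b} \<times> cbox c v) (\<lambda>(x, t). Qu (x, t))"
      using contQu by (simp add: split_beta')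
  qed (use u in auto)
  then show ?thesis
    using u by (simp add: at_within_Icc_at)
qed

text \<open>Write \<open>f(u,v) - f(u,c)\<close> as the integral of \<open>fv\<close> over
  \<open>{c..v}\<close> and differentiate in u under the integral sign:
  \<open>fu(u,v) - fu(u,c)\<close> is the integral of \<open>fvu\<close>. The fundamental theorem of
  calculus then gives its v-derivative as \<open>fvu\<close>.\<close>

lemma mixed_partials_eq:
  fixes f :: "param \<Rightarrow> 'a::banach"
  assumes "open U" "p \<in> U"
    and f: "\<And>q. q \<in> U \<Longrightarrow> has_partials f (fu q) (fv q) q"
    and fu: "\<And>q. q \<in> U \<Longrightarrow> has_partials fu (fuu q) (fuv q) q"
    and fv: "\<And>q. q \<in> U \<Longrightarrow> has_partials fv (fvu q) (fvv q) q"
    and cont: "continuous_on U fvu"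
  shows "fuv p = fvu p"
proof -
  obtain a b c d where ab: "a < fst p" "fst p < b" "c < snd p" "snd p < d"
    and U: "{a..b} \<times> {c..d} \<subseteq> U"
    using open_contains_rectangle[OF assms(1,2)] by metis
  let ?u = "fst p"
  have eq: "fu (?u, v) - fu (?u, c) = integral {c..v} (\<lambda>t. fvu (?u, t))" if v: "v \<in> {c..d}" for v
  proof -
    have sub: "{a..b} \<times> {c..v} \<subseteq> U" using U v by auto
    have ftc: "f (s, v) - f (s, c) = integral {c..v} (\<lambda>t. fv (s, t))" if "s \<in> {a<..<b}" for s
    proof (rule sym, rule integral_unique, rule fundamental_theorem_of_calculus)
      show "((\<lambda>t. f (s, t)) has_vector_derivative fv (s, t)) (at t within {c..v})" if "t \<in> {c..v}" for t
      proof -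
        have "(s, t) \<in> U" using \<open>s \<in> _\<close> that sub by auto
        from has_partials_pdv(1)[OF f[OF this]] show ?thesis
          by (auto intro: has_vector_derivative_at_within)
      qed
    qed (use v in auto)
    have "((\<lambda>s. integral {c..v} (\<lambda>t. fv (s, t))) has_vector_derivative integral {c..v} (\<lambda>t. fvu (?u, t))) (at ?u)"
    proof (rule has_vector_derivative_integral_param)
      show "((\<lambda>s. fv (s, snd q)) has_vector_derivative fvu q) (at (fst q))" if "q \<in> {a..b} \<times> {c..v}" for q
        using has_partials_pdu(1)[OF fv, of q] that sub by auto
      show "continuous_on ({a..b} \<times> {c..v}) fv"
        using continuous_on_subset[OF has_partials_continuous_on[OF fv] sub] by simp
      show "continuous_on ({a..b} \<times> {c..v}) fvu"
        using continuous_on_subset[OF cont sub] .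
    qed (use ab in auto)
    then have 1: "((\<lambda>s. f (s, v) - f (s, c)) has_vector_derivative integral {c..v} (\<lambda>t. fvu (?u, t))) (at ?u)"
      by (rule has_vector_derivative_transform_within_open[of _ _ _ "{a<..<b}"]) (use ab ftc in auto)
    have mem: "(?u, v) \<in> U" "(?u, c) \<in> U" using U v ab by auto
    have 2: "((\<lambda>s. f (s, v) - f (s, c)) has_vector_derivative fu (?u, v) - fu (?u, c)) (at ?u)"
      using has_partials_pdu(1)[OF f[OF mem(1)]] has_partials_pdu(1)[OF f[OF mem(2)]]
      by (auto intro: has_vector_derivative_diff)
    show ?thesis by (rule vector_derivative_unique_at[OF 2 1])
  qed
  have "((\<lambda>v. integral {c..v} (\<lambda>t. fvu (?u, t))) has_vector_derivative fvu (?u, snd p)) (at (snd p) within {c..d})"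
    by (rule integral_has_vector_derivative)
      (use U ab in \<open>auto intro!: continuous_on_compose2[OF cont] continuous_intros\<close>)
  then have "((\<lambda>v. integral {c..v} (\<lambda>t. fvu (?u, t))) has_vector_derivative fvu p) (at (snd p))"
    using ab by (simp add: at_within_Icc_at)
  then have 1: "((\<lambda>v. fu (?u, v) - fu (?u, c)) has_vector_derivative fvu p) (at (snd p))"
    by (rule has_vector_derivative_transform_within_open[of _ _ _ "{c<..<d}"]) (use ab eq in auto)
  have 2: "((\<lambda>v. fu (?u, v) - fu (?u, c)) has_vector_derivative fuv p - 0) (at (snd p))"
    by (intro has_vector_derivative_diff has_partials_pdv(1)[OF fu] assms has_vector_derivative_const)
  show ?thesis using vector_derivative_unique_at[OF 2 1] by simp
qed

text \<open>The common source of all integrability conditions below: the second derivatives of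
  \<open>f\<close> drop out, leaving first derivatives only. With \<open>f = z\<close> and
  \<open>n\<close> tangent it yields the exterior derivative of the coframe; with \<open>f\<close> a
  tangent frame field and \<open>n\<close> normal it yields a Codazzi equation.\<close>

lemma mixed_partials_inner:
  fixes f n :: "param \<Rightarrow> 'a::euclidean_space"
  assumes "open U" "Ck 2 U f" "Ck 1 U n" "p \<in> U"
  shows "pdv (\<lambda>q. n q \<bullet> pdu f q) p - pdu (\<lambda>q. n q \<bullet> pdv f q) p = pdv n p \<bullet> pdu f p - pdu n p \<bullet> pdv f p"
proof -
  have Ck: "Ck (Suc (Suc 0)) U f" "Ck (Suc 0) U n" using assms by (simp_all add: numeral_2_eq_2)
  note Ck1 = Ck_pdu_pdv[OF assms(1) Ck(1)]
  note n = Ck_has_partials[OF Ck(2) assms(4)]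
  have mixed: "pdv (pdu f) p = pdu (pdv f) p"
    by (rule mixed_partials_eq[OF assms(1,4) Ck_has_partials Ck_has_partials Ck_has_partials, OF Ck(1) _ Ck1(1) _ Ck1(2)])
      (auto intro: Ck_continuous_on Ck_pdu_pdv assms(1) Ck1)
  show ?thesis
    using has_partials_pdv(2)[OF has_partials_inner[OF n Ck_has_partials[OF Ck1(1) assms(4)]]]
      has_partials_pdu(2)[OF has_partials_inner[OF n Ck_has_partials[OF Ck1(2) assms(4)]]] mixed
    by simp
qed

text \<open>Closedness of \<open>P du + Q dv\<close> is expressed by the shared function
  \<open>R\<close>, which is the v-partial of \<open>P\<close> and the u-partial of
  \<open>Q\<close>.\<close>

lemma closed_form_potential:
  fixes P Q :: "param \<Rightarrow> 'a::banach"
  assumes "open U" and U: "{a..b} \<times> {c..d} \<subseteq> U"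
    and P: "\<And>q. q \<in> U \<Longrightarrow> has_partials P (Pu q) (R q) q"
    and Q: "\<And>q. q \<in> U \<Longrightarrow> has_partials Q (R q) (Qv q) q"
    and cont: "continuous_on U R"
  obtains f where "\<And>q. q \<in> {a<..<b} \<times> {c<..<d} \<Longrightarrow> has_partials f (P q) (Q q) q"
proof -
  \<comment> \<open>The line integral of the form from the corner \<open>(a, c)\<close>:
    horizontally at height \<open>c\<close>, then vertically up to \<open>q\<close>.\<close>
  define f where "f q = integral {a..fst q} (\<lambda>s. P (s, c)) + integral {c..snd q} (\<lambda>t. Q (fst q, t))" for q
  let ?S = "{a<..<b} \<times> {c<..<d}"
  have contP: "continuous_on U P" and contQ: "continuous_on U Q"
    using has_partials_continuous_on P Q by blast+
  have "has_partials f (P q) (Q q) q" if q: "q \<in> ?S" for q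
  proof (rule has_partials_continuous_partials[where U = ?S])
    show "open ?S" by (intro open_Times) auto
    show "q \<in> ?S" by fact
    show "continuous_on ?S Q"
      by (rule continuous_on_subset[OF contQ]) (use U in auto)
    fix q assume q: "q \<in> ?S"
    then obtain u v where uv: "q = (u, v)" "a < u" "u < b" "c < v" "v < d" by (cases q) auto
    have sub: "{a..b} \<times> {c..v} \<subseteq> U" using U uv by auto
    have "((\<lambda>v. integral {c..v} (\<lambda>t. Q (u, t))) has_vector_derivative Q (u, v)) (at v within {c..d})"
      by (rule integral_has_vector_derivative)
        (use U uv in \<open>auto intro!: continuous_on_compose2[OF contQ] continuous_intros\<close>)
    then have "((\<lambda>v. integral {c..v} (\<lambda>t. Q (u, t))) has_vector_derivative Q q) (at v)"
      using uv by (simp add: at_within_Icc_at)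
    from has_vector_derivative_add[OF has_vector_derivative_const this]
    show "((\<lambda>t. f (fst q, t)) has_vector_derivative Q q) (at (snd q))"
      using uv by (simp add: f_def)
    have "((\<lambda>u. integral {a..u} (\<lambda>s. P (s, c))) has_vector_derivative P (u, c)) (at u within {a..b})"
      by (rule integral_has_vector_derivative)
        (use U uv in \<open>auto intro!: continuous_on_compose2[OF contP] continuous_intros\<close>)
    then have 1: "((\<lambda>u. integral {a..u} (\<lambda>s. P (s, c))) has_vector_derivative P (u, c)) (at u)"
      using uv by (simp add: at_within_Icc_at)
    have 2: "((\<lambda>u. integral {c..v} (\<lambda>t. Q (u, t))) has_vector_derivative integral {c..v} (\<lambda>t. R (u, t))) (at u)"
    proof (rule has_vector_derivative_integral_param)
      show "((\<lambda>s. Q (s, snd q)) has_vector_derivative R q) (at (fst q))" if "q \<in> {a..b} \<times> {c..v}" for q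
        using has_partials_pdu(1)[OF Q, of q] that sub by auto
    qed (use uv sub continuous_on_subset contQ cont in blast)+
    \<comment> \<open>Closedness enters here: the integrand obtained from \<open>Q\<close> is also
      the v-partial of \<open>P\<close>, so the u-derivative of the vertical integral exactly
      corrects \<open>P (u, c)\<close> to \<open>P (u, v)\<close>.\<close>
    have "((\<lambda>t. R (u, t)) has_integral P (u, v) - P (u, c)) {c..v}"
    proof (rule fundamental_theorem_of_calculus)
      show "((\<lambda>t. P (u, t)) has_vector_derivative R (u, t)) (at t within {c..v})" if "t \<in> {c..v}" for t
      proof -
        have "(u, t) \<in> U" using that sub uv by auto
        from has_partials_pdv(1)[OF P[OF this]] show ?thesis
          by (auto intro: has_vector_derivative_at_within)
      qed
    qed (use uv in auto)
    then have "P (u, c) + integral {c..v} (\<lambda>t. R (u, t)) = P q"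
      using uv by (simp add: integral_unique)
    with has_vector_derivative_add[OF 1 2]
    show "((\<lambda>s. f (s, snd q)) has_vector_derivative P q) (at (fst q))"
      using uv by (simp add: f_def)
  qed
  then show thesis by (rule that)
qed

text \<open>\<open>D\<close> is the Jacobian determinant of \<open>(f1, f2)\<close>. The derivative
  of the inverse is given explicitly by Cramer's rule; these formulas serve both to compute the new
  coordinate fields and to prove that the inverse is smooth.\<close>

lemma smooth_local_inverse:
  fixes f1 f2 P Q A B :: "param \<Rightarrow> real"
  assumes "open S" "p0 \<in> S"
    and f1: "\<And>p. p \<in> S \<Longrightarrow> has_partials f1 (P p) (Q p) p"
    and f2: "\<And>p. p \<in> S \<Longrightarrow> has_partials f2 (A p) (B p) p"
    and Ck: "\<And>k. Ck k S P" "\<And>k. Ck k S Q" "\<And>k. Ck k S A" "\<And>k. Ck k S B"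
    and D: "\<And>p. D p = P p * B p - Q p * A p" "\<And>p. p \<in> S \<Longrightarrow> D p \<noteq> 0"
  obtains V W \<phi> where "p0 \<in> V" "V \<subseteq> S" "diffeo_pl W V \<phi>"
    "\<And>q. q \<in> W \<Longrightarrow> has_partials \<phi> (B (\<phi> q) / D (\<phi> q), - A (\<phi> q) / D (\<phi> q))
       (- Q (\<phi> q) / D (\<phi> q), P (\<phi> q) / D (\<phi> q)) q"
proof -
  define \<psi> where "\<psi> p = (f1 p, f2 p)" for p
  have \<psi>: "has_partials \<psi> (P p, A p) (Q p, B p) p" if "p \<in> S" for p
    unfolding \<psi>_def using f1 f2 that by (intro has_partials_Pair)
  \<comment> \<open>The linear map with columns \<open>a\<close> and \<open>b\<close>, taken as a
    bounded linear function because the inverse function theorem asks for a derivative that is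
    continuous as an operator-valued map.\<close>
  define L :: "param \<Rightarrow> param \<Rightarrow> param \<Rightarrow>\<^sub>L param" where
    "L a b = (blinfun_scaleR_left a o\<^sub>L Blinfun fst) + (blinfun_scaleR_left b o\<^sub>L Blinfun snd)" for a b
  have L: "blinfun_apply (L a b) = (\<lambda>h. fst h *\<^sub>R a + snd h *\<^sub>R b)" for a b
    by (auto simp: L_def blinfun.add_left bounded_linear_Blinfun_apply bounded_linear_fst bounded_linear_snd
        intro!: ext)
  \<comment> \<open>The inverse Jacobian: the adjugate matrix divided by the determinant, by
    columns.\<close>
  define M where "M p = L (B p / D p, - A p / D p) (- Q p / D p, P p / D p)" for p
  have MM: "blinfun_apply (M p) (blinfun_apply (L (P p, A p) (Q p, B p)) h) = h"
    "blinfun_apply (L (P p, A p) (Q p, B p)) (blinfun_apply (M p) h) = h" if "p \<in> S" for p h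
  proof -
    have "P p * B p / D p - Q p * A p / D p = 1"
      using D[of p] that by (metis diff_divide_distrib divide_self)
    then have e: "P p * B p / D p = 1 + Q p * A p / D p" by simp
    show "blinfun_apply (M p) (blinfun_apply (L (P p, A p) (Q p, B p)) h) = h"
      "blinfun_apply (L (P p, A p) (Q p, B p)) (blinfun_apply (M p) h) = h"
      unfolding M_def L using e
      by (simp_all add: prod_eq_iff distrib_left distrib_right mult.assoc[symmetric] add_divide_distrib, algebra+)
  qed
  have cont: "continuous_on S (\<lambda>p. L (P p, A p) (Q p, B p))"
    unfolding L_def
    by (intro continuous_intros bounded_linear.continuous_on[OF bounded_linear_blinfun_scaleR_left]
        Ck_continuous_on[of 0] Ck)
  have \<psi>': "(\<psi> has_derivative blinfun_apply (L (P p, A p) (Q p, B p))) (at p)" if "p \<in> S" for p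
    using \<psi>[OF that] unfolding has_partials_def L .
  have left_inv: "M p0 o\<^sub>L L (P p0, A p0) (Q p0, B p0) = id_blinfun"
    by (rule blinfun_eqI) (simp add: MM assms(2))
  obtain V W \<phi> \<phi>' where V: "open V" "V \<subseteq> S" "p0 \<in> V" and W: "open W"
    and hom: "homeomorphism V W \<psi> \<phi>"
    and der: "\<And>q. q \<in> W \<Longrightarrow> (\<phi> has_derivative \<phi>' q) (at q)"
      "\<And>q. q \<in> W \<Longrightarrow> \<phi>' q = inv (blinfun_apply (L (P (\<phi> q), A (\<phi> q)) (Q (\<phi> q), B (\<phi> q))))"
  proof (rule inverse_function_theorem[OF assms(1) \<psi>' cont assms(2) left_inv], assumption, goal_cases)
    case (1 V W \<phi> \<phi>')
    show thesis by (rule 1(1)[OF 1(2,3,4,5,7,8,9)])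
  qed
  have img: "\<phi> ` W = V" "\<psi> ` V = W" and inv: "\<And>q. q \<in> W \<Longrightarrow> \<psi> (\<phi> q) = q" "\<And>p. p \<in> V \<Longrightarrow> \<phi> (\<psi> p) = p"
    using hom by (auto simp: homeomorphism_def)
  have \<phi>: "has_partials \<phi> (B (\<phi> q) / D (\<phi> q), - A (\<phi> q) / D (\<phi> q))
       (- Q (\<phi> q) / D (\<phi> q), P (\<phi> q) / D (\<phi> q)) q" if "q \<in> W" for q
  proof -
    have "\<phi> q \<in> S" using that img V by auto
    then have "\<phi>' q = blinfun_apply (M (\<phi> q))"
      unfolding der(2)[OF that] by (intro inv_unique_comp) (auto simp: MM fun_eq_iff)
    with der(1)[OF that] show ?thesis by (simp add: has_partials_def M_def L)
  qed
  have Ck\<psi>: "Ck k S \<psi>" for k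
    by (rule Ck_Suc, rule Ck_SucI[OF Ck_Pair Ck_Pair, OF Ck(1,3) Ck(2,4)]) (rule \<psi>)
  have CkD: "Ck k S D" for k
    by (rule Ck_cong[OF assms(1) Ck_diff, OF Ck_mult Ck_mult, OF Ck(1,4) Ck(2,3)]) (simp add: D)
  have sub: "\<phi> ` W \<subseteq> S" using img V by simp
  \<comment> \<open>Bootstrapping: the partials of \<open>\<phi>\<close> are smooth functions
    evaluated at \<open>\<phi>\<close>, so each order gained by \<open>\<phi>\<close> passes to its
    partials and yields the next.\<close>
  have Ck\<phi>: "Ck k W \<phi>" for k
  proof (induction k)
    case 0
    show ?case using has_partials_continuous_on[OF \<phi>] by simp
  next
    case (Suc k)
    have "Ck k S (\<lambda>p. (B p / D p, - A p / D p))" "Ck k S (\<lambda>p. (- Q p / D p, P p / D p))"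
      by (intro Ck_Pair Ck_divide Ck_minus Ck CkD D(2) assms(1); assumption)+
    from this[THEN Ck_compose[OF sub], OF Suc.IH]
    show ?case by (rule Ck_SucI) (unfold o_def, rule \<phi>)
  qed
  have "diffeo_pl W V \<phi>"
    unfolding diffeo_pl_def
    using Ck_smooth_on_pl[OF W Ck\<phi>] Ck_smooth_on_pl[OF V(1) Ck_subset[OF Ck\<psi> V(2)]] img inv V W
    by blast
  then show thesis using that V \<phi> by blast
qed

subsection \<open>The coframe of a minimal surface with vanishing $\gamma_1$\<close>

text \<open>The span of two vectors has dimension at most 2, so the independent pair
  \<open>x\<close>, \<open>y\<close> inside it already spans it.\<close>

lemma orthonormal_expansion_span2:
  fixes x y a b :: "'a::euclidean_space"
  assumes "x \<in> span {a, b}" "y \<in> span {a, b}" "x \<bullet> x = 1" "y \<bullet> y = 1" "x \<bullet> y = 0"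
    and "w \<in> span {a, b}"
  shows "w = (x \<bullet> w) *\<^sub>R x + (y \<bullet> w) *\<^sub>R y"
proof -
  have ne: "x \<noteq> y" "x \<noteq> 0" "y \<noteq> 0" using assms by auto
  have "pairwise orthogonal {x, y}"
    using assms by (auto simp: pairwise_def orthogonal_def inner_commute)
  then have ind: "independent {x, y}"
    using ne by (intro pairwise_orthogonal_independent) auto
  have "span {x, y} \<subseteq> span {a, b}"
    using assms by (intro span_minimal) auto
  moreover have "dim (span {a, b}) \<le> 2"
    using dim_le_card[of "span {a, b}" "{a, b}"] card_insert_le_m1[of 2 "{b}" a] by (simp add: dim_span)
  moreover have "dim (span {x, y}) = 2"
    using ind ne by (simp add: dim_span dim_eq_card_independent)
  ultimately have "span {x, y} = span {a, b}"
    by (intro subspace_dim_equal) auto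
  with assms(6) have "w \<in> span {x, y}" by simp
  then obtain c d where "w = c *\<^sub>R x + d *\<^sub>R y"
    by (auto simp: span_insert algebra_simps)
  with assms show ?thesis by (simp add: inner_add_right inner_commute)
qed

text \<open>Collects coefficients as in a 2x2 matrix product, so that vector identities reduce to
  rewriting with scalar ones.\<close>

lemma scaleR_combination:
  "a *\<^sub>R (b *\<^sub>R v + c *\<^sub>R w) + d *\<^sub>R (e *\<^sub>R v + f *\<^sub>R w) =
    (a * b + d * e) *\<^sub>R v + (a * c + d * f) *\<^sub>R (w :: 'a::real_vector)"
  by (simp add: algebra_simps)

locale minimal_geometric_frame =
  fixes U :: "param set" and z x y n1 n2 :: "param \<Rightarrow> pt4"
    and \<nu> \<mu> \<gamma>\<^sub>1 \<gamma>\<^sub>2 \<beta>\<^sub>1 \<beta>\<^sub>2 :: "param \<Rightarrow> real"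
  assumes reg: "regular_surface U z"
    and gf: "geometric_frame U z x y n1 n2 \<nu> \<mu> \<gamma>\<^sub>1 \<gamma>\<^sub>2 \<beta>\<^sub>1 \<beta>\<^sub>2"
    and \<gamma>\<^sub>1: "\<And>p. p \<in> U \<Longrightarrow> \<gamma>\<^sub>1 p = 0"
begin

text \<open>\<open>xu\<close>, \<open>xv\<close> and \<open>yu\<close>, \<open>yv\<close> are the
  coefficients of the coframe dual to \<open>x\<close>, \<open>y\<close>, and \<open>J\<close> is
  that of its area form. The sign of \<open>J\<close> is not fixed, as the frame may reverse the
  orientation of the parameters.\<close>

definition xu where "xu p = x p \<bullet> pdu z p"
definition xv where "xv p = x p \<bullet> pdv z p"
definition yu where "yu p = y p \<bullet> pdu z p"
definition yv where "yv p = y p \<bullet> pdv z p"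
definition J where "J p = xu p * yv p - xv p * yu p"

lemma openU: "open U" and EG: "p \<in> U \<Longrightarrow> EE z p * GG z p - (FF z p)^2 > 0"
  and smooth_z: "smooth_on_pl U z"
  using reg by (auto simp: regular_surface_def)

lemma Ck_frame: "Ck k U z" "Ck k U x" "Ck k U y" "Ck k U n1" "Ck k U n2"
  using gf smooth_z openU by (auto simp: geometric_frame_def adapted_frame_def intro: smooth_on_pl_Ck)

lemma frame:
  assumes "p \<in> U"
  shows "x p \<in> span {pdu z p, pdv z p}" "y p \<in> span {pdu z p, pdv z p}"
    "x p \<bullet> x p = 1" "y p \<bullet> y p = 1" "n1 p \<bullet> n1 p = 1" "n2 p \<bullet> n2 p = 1"
    "x p \<bullet> y p = 0" "x p \<bullet> n1 p = 0" "x p \<bullet> n2 p = 0" "y p \<bullet> n1 p = 0" "y p \<bullet> n2 p = 0" "n1 p \<bullet> n2 p = 0"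
    "y p \<bullet> x p = 0" "n1 p \<bullet> x p = 0" "n2 p \<bullet> x p = 0" "n1 p \<bullet> y p = 0" "n2 p \<bullet> y p = 0" "n2 p \<bullet> n1 p = 0"
  using gf assms
  by (auto simp: geometric_frame_def adapted_frame_def adapted_frame_at_def tplane_def inner_commute)

lemma
  assumes "p \<in> U"
  shows pdu_z: "pdu z p = xu p *\<^sub>R x p + yu p *\<^sub>R y p"
    and pdv_z: "pdv z p = xv p *\<^sub>R x p + yv p *\<^sub>R y p"
  unfolding xu_def yu_def xv_def yv_def
  by (rule orthonormal_expansion_span2[OF frame(1,2,3,4,7)[OF assms]]; simp add: span_base)+

text \<open>In an orthonormal basis the Gram determinant of \<open>z_u\<close>, \<open>z_v\<close>
  is the square of their coordinate determinant.\<close>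

lemma J_nonzero:
  assumes "p \<in> U"
  shows "J p \<noteq> 0"
proof
  assume "J p = 0"
  moreover have "EE z p * GG z p - (FF z p)^2 = (J p)^2"
    unfolding EE_def FF_def GG_def pdu_z[OF assms] pdv_z[OF assms] J_def
    by (simp add: frame[OF assms] inner_add_left inner_add_right) algebra
  ultimately show False using EG[OF assms] by simp
qed

text \<open>Cramer's rule for the passage from \<open>x\<close>, \<open>y\<close> to the coordinate
  basis. The definite description also demands uniqueness, which pairing with \<open>x\<close> and
  \<open>y\<close> supplies.\<close>

lemma tcoords_eq:
  assumes p: "p \<in> U"
  shows "tcoords z p (a *\<^sub>R x p + b *\<^sub>R y p) = ((a * yv p - b * xv p) / J p, (b * xu p - a * yu p) / J p)"
  unfolding tcoords_def
proof (rule the_equality)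
  note J = J_nonzero[OF p]
  show "a *\<^sub>R x p + b *\<^sub>R y p = fst ((a * yv p - b * xv p) / J p, (b * xu p - a * yu p) / J p) *\<^sub>R pdu z p +
      snd ((a * yv p - b * xv p) / J p, (b * xu p - a * yu p) / J p) *\<^sub>R pdv z p"
  proof -
    have "(a * yv p - b * xv p) / J p * xu p + (b * xu p - a * yu p) / J p * xv p = a"
      "(a * yv p - b * xv p) / J p * yu p + (b * xu p - a * yu p) / J p * yv p = b"
      using J by (simp_all add: divide_simps, simp_all add: J_def algebra_simps)
    then show ?thesis
      unfolding pdu_z[OF p] pdv_z[OF p] by (simp add: algebra_simps flip: scaleR_add_left)
  qed
  fix cd :: param
  assume *: "a *\<^sub>R x p + b *\<^sub>R y p = fst cd *\<^sub>R pdu z p + snd cd *\<^sub>R pdv z p"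
  from arg_cong[OF *, of "\<lambda>w. x p \<bullet> w"] arg_cong[OF *, of "\<lambda>w. y p \<bullet> w"]
  have "a = fst cd * xu p + snd cd * xv p" "b = fst cd * yu p + snd cd * yv p"
    unfolding pdu_z[OF p] pdv_z[OF p] by (simp_all add: frame[OF p] inner_add_left inner_add_right)
  then have "a * yv p - b * xv p = fst cd * J p" "b * xu p - a * yu p = snd cd * J p"
    unfolding J_def by (simp_all add: algebra_simps)
  then show "cd = ((a * yv p - b * xv p) / J p, (b * xu p - a * yu p) / J p)"
    using J by (simp add: prod_eq_iff)
qed

text \<open>Inverts the definition of \<open>dD\<close>, so that the structure equations determine
  the coordinate derivatives of the frame, to which equality of mixed partials applies.\<close>

lemma
  assumes p: "p \<in> U"
  shows pdu_dD: "pdu W p = xu p *\<^sub>R dD z x W p + yu p *\<^sub>R dD z y W p"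
    and pdv_dD: "pdv W p = xv p *\<^sub>R dD z x W p + yv p *\<^sub>R dD z y W p"
proof -
  note J = J_nonzero[OF p]
  have dx: "dD z x W p = (yv p / J p) *\<^sub>R pdu W p + (- yu p / J p) *\<^sub>R pdv W p"
    using tcoords_eq[OF p, of 1 0] by (simp add: dD_def)
  have dy: "dD z y W p = (- xv p / J p) *\<^sub>R pdu W p + (xu p / J p) *\<^sub>R pdv W p"
    using tcoords_eq[OF p, of 0 1] by (simp add: dD_def)
  have eqs: "xu p * (yv p / J p) + yu p * (- xv p / J p) = 1" "xu p * (- yu p / J p) + yu p * (xu p / J p) = 0"
    "xv p * (yv p / J p) + yv p * (- xv p / J p) = 0" "xv p * (- yu p / J p) + yv p * (xu p / J p) = 1"
    using J by (simp_all add: divide_simps, simp_all add: J_def algebra_simps)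
  show "pdu W p = xu p *\<^sub>R dD z x W p + yu p *\<^sub>R dD z y W p"
    "pdv W p = xv p *\<^sub>R dD z x W p + yv p *\<^sub>R dD z y W p"
    unfolding dx dy scaleR_combination eqs by simp_all
qed

lemma structure_eqs:
  assumes p: "p \<in> U"
  shows "dD z x x p = \<nu> p *\<^sub>R n1 p" "dD z x y p = \<mu> p *\<^sub>R n2 p"
    "dD z y x p = - \<gamma>\<^sub>2 p *\<^sub>R y p + \<mu> p *\<^sub>R n2 p"
    "dD z y y p = \<gamma>\<^sub>2 p *\<^sub>R x p - \<nu> p *\<^sub>R n1 p"
    "dD z x n1 p = - \<nu> p *\<^sub>R x p + \<beta>\<^sub>1 p *\<^sub>R n2 p"
    "dD z y n1 p = \<nu> p *\<^sub>R y p + \<beta>\<^sub>2 p *\<^sub>R n2 p"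
    "dD z x n2 p = - \<mu> p *\<^sub>R y p - \<beta>\<^sub>1 p *\<^sub>R n1 p"
    "dD z y n2 p = - \<mu> p *\<^sub>R x p - \<beta>\<^sub>2 p *\<^sub>R n1 p"
  and \<mu>\<nu>: "(\<mu> p)^2 \<noteq> (\<nu> p)^2"
  using gf p \<gamma>\<^sub>1[OF p] by (auto simp: geometric_frame_def)

text \<open>Each normal component is a coframe coefficient times an invariant, up to sign. This
  allows solving for \<open>\<nu>\<close> and \<open>\<mu>\<close>, and makes their derivatives
  appear once mixed partials of \<open>x\<close> and \<open>y\<close> are paired with
  normals.\<close>

lemma inner_pd:
  assumes p: "p \<in> U"
  shows "n1 p \<bullet> pdu x p = xu p * \<nu> p" "n1 p \<bullet> pdv x p = xv p * \<nu> p"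
    "n2 p \<bullet> pdu x p = yu p * \<mu> p" "n2 p \<bullet> pdv x p = yv p * \<mu> p"
    "n1 p \<bullet> pdu y p = - (yu p * \<nu> p)" "n1 p \<bullet> pdv y p = - (yv p * \<nu> p)"
    "n2 p \<bullet> pdu y p = xu p * \<mu> p" "n2 p \<bullet> pdv y p = xv p * \<mu> p"
  unfolding pdu_dD[OF p] pdv_dD[OF p] structure_eqs[OF p]
  by (simp_all add: frame[OF p] inner_add_right inner_diff_right)

section \<open>Smoothness of the coframe and of the invariants\<close>

lemma Ck_coeffs: "Ck k U xu" "Ck k U xv" "Ck k U yu" "Ck k U yv" "Ck k U J"
proof -
  show *: "Ck k U xu" "Ck k U xv" "Ck k U yu" "Ck k U yv"
    unfolding xu_def xv_def yu_def yv_def by (intro Ck_inner Ck_frame Ck_pdu_pdv openU)+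
  show "Ck k U J" unfolding J_def by (intro Ck_diff Ck_mult *)
qed

text \<open>The frame yields \<open>xu * \<nu>\<close> and \<open>xv * \<nu>\<close>, but either
  coefficient may vanish somewhere. Combining them with \<open>yv\<close> and \<open>yu\<close>
  gives \<open>J * \<nu>\<close>, where the factor \<open>J\<close> never vanishes.\<close>

lemma Ck_\<nu>: "Ck k U \<nu>"
proof (rule Ck_cong[OF openU])
  show "Ck k U (\<lambda>p. ((n1 p \<bullet> pdu x p) * yv p - (n1 p \<bullet> pdv x p) * yu p) / J p)"
    by (intro Ck_divide Ck_diff Ck_mult Ck_inner Ck_frame Ck_coeffs Ck_pdu_pdv openU J_nonzero)
  show "((n1 p \<bullet> pdu x p) * yv p - (n1 p \<bullet> pdv x p) * yu p) / J p = \<nu> p" if "p \<in> U" for p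
    using J_nonzero[OF that] by (simp add: inner_pd that field_simps) (simp add: J_def algebra_simps)
qed

lemma Ck_\<mu>: "Ck k U \<mu>"
proof (rule Ck_cong[OF openU])
  show "Ck k U (\<lambda>p. ((n2 p \<bullet> pdu y p) * yv p - (n2 p \<bullet> pdv y p) * yu p) / J p)"
    by (intro Ck_divide Ck_diff Ck_mult Ck_inner Ck_frame Ck_coeffs Ck_pdu_pdv openU J_nonzero)
  show "((n2 p \<bullet> pdu y p) * yv p - (n2 p \<bullet> pdv y p) * yu p) / J p = \<mu> p" if "p \<in> U" for p
    using J_nonzero[OF that] by (simp add: inner_pd that field_simps) (simp add: J_def algebra_simps)
qed

text \<open>With \<open>\<gamma>\<^sub>1 = 0\<close> the derivatives \<open>x_u\<close>,
  \<open>x_v\<close> have tangential parts \<open>- \<gamma>\<^sub>2 yu y\<close> and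
  \<open>- \<gamma>\<^sub>2 yv y\<close>. The curl is then a multiple of
  \<open>yu yv - yv yu\<close>.\<close>

lemma xu_xv_closed:
  assumes p: "p \<in> U"
  shows "pdv xu p = pdu xv p"
  using mixed_partials_inner[OF openU Ck_frame(1,2) p]
  unfolding xu_def[abs_def, symmetric] xv_def[abs_def, symmetric]
    pdu_dD[OF p, of x] pdv_dD[OF p, of x] pdu_z[OF p] pdv_z[OF p] structure_eqs[OF p]
  by (simp add: frame[OF p] inner_add_left inner_add_right inner_diff_left inner_diff_right)

text \<open>The tangential parts of \<open>y_u\<close>, \<open>y_v\<close> are
  \<open>\<gamma>\<^sub>2 yu x\<close> and \<open>\<gamma>\<^sub>2 yv x\<close>, which leaves a
  multiple of \<open>J\<close>. This is the defect that the factor \<open>g\<close> has to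
  remove.\<close>

lemma yu_yv_curl:
  assumes p: "p \<in> U"
  shows "pdv yu p - pdu yv p = \<gamma>\<^sub>2 p * J p"
  using mixed_partials_inner[OF openU Ck_frame(1,3) p]
  unfolding yu_def[abs_def, symmetric] yv_def[abs_def, symmetric]
    pdu_dD[OF p, of y] pdv_dD[OF p, of y] pdu_z[OF p] pdv_z[OF p] structure_eqs[OF p] J_def
  by (simp add: frame[OF p] inner_add_left inner_add_right inner_diff_left inner_diff_right algebra_simps)

text \<open>Divided by \<open>- J\<close>, the left side is the derivative of \<open>\<mu>\<close>
  along \<open>x\<close>. The field \<open>x\<close> is paired with \<open>n2\<close> because the
  resulting coefficients are \<open>\<mu>\<close> times \<open>yu\<close>, \<open>yv\<close>, so
  that only this direction occurs. One copy of \<open>\<gamma>\<^sub>2 \<mu>\<close> comes from the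
  derivatives of \<open>n2\<close>, the other from the curl of \<open>yu\<close>,
  \<open>yv\<close>.\<close>

lemma codazzi_\<mu>:
  assumes p: "p \<in> U"
  shows "yu p * pdv \<mu> p - yv p * pdu \<mu> p = - J p * (2 * \<gamma>\<^sub>2 p * \<mu> p + \<nu> p * \<beta>\<^sub>2 p)"
proof -
  have "pdv (\<lambda>q. yu q * \<mu> q) p = pdv yu p * \<mu> p + yu p * pdv \<mu> p"
    "pdu (\<lambda>q. yv q * \<mu> q) p = pdu yv p * \<mu> p + yv p * pdu \<mu> p"
    by (rule pd_mult[OF _ _ p], (rule Ck_coeffs Ck_\<mu>)+)+
  moreover have "pdv (\<lambda>q. n2 q \<bullet> pdu x q) p = pdv (\<lambda>q. yu q * \<mu> q) p"
    by (rule pd_cong[OF openU p]) (intro Ck_inner Ck_frame Ck_pdu_pdv openU, simp add: inner_pd)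
  moreover have "pdu (\<lambda>q. n2 q \<bullet> pdv x q) p = pdu (\<lambda>q. yv q * \<mu> q) p"
    by (rule pd_cong[OF openU p]) (intro Ck_inner Ck_frame Ck_pdu_pdv openU, simp add: inner_pd)
  moreover have "pdv n2 p \<bullet> pdu x p - pdu n2 p \<bullet> pdv x p = - J p * (\<gamma>\<^sub>2 p * \<mu> p + \<nu> p * \<beta>\<^sub>2 p)"
    unfolding pdu_dD[OF p, of x] pdv_dD[OF p, of x] pdu_dD[OF p, of n2] pdv_dD[OF p, of n2] structure_eqs[OF p] J_def
    by (simp add: frame[OF p] inner_add_left inner_add_right inner_diff_left inner_diff_right algebra_simps)
  ultimately show ?thesis
    using mixed_partials_inner[OF openU Ck_frame(2,5) p] yu_yv_curl[OF p] by algebra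
qed

text \<open>The same argument with \<open>y\<close> paired with \<open>n1\<close>, whose
  coefficients are \<open>- \<nu>\<close> times \<open>yu\<close>, \<open>yv\<close>.\<close>

lemma codazzi_\<nu>:
  assumes p: "p \<in> U"
  shows "yu p * pdv \<nu> p - yv p * pdu \<nu> p = - J p * (2 * \<gamma>\<^sub>2 p * \<nu> p + \<mu> p * \<beta>\<^sub>2 p)"
proof -
  have "pdv (\<lambda>q. - yu q * \<nu> q) p = - pdv yu p * \<nu> p + - yu p * pdv \<nu> p"
    "pdu (\<lambda>q. - yv q * \<nu> q) p = - pdu yv p * \<nu> p + - yv p * pdu \<nu> p"
    by (simp_all add: pd_minus[OF Ck_mult, OF Ck_coeffs(3) Ck_\<nu> p] pd_minus[OF Ck_mult, OF Ck_coeffs(4) Ck_\<nu> p]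
        pd_mult[OF Ck_coeffs(3) Ck_\<nu> p] pd_mult[OF Ck_coeffs(4) Ck_\<nu> p])
  moreover have "pdv (\<lambda>q. n1 q \<bullet> pdu y q) p = pdv (\<lambda>q. - yu q * \<nu> q) p"
    by (rule pd_cong[OF openU p]) (intro Ck_inner Ck_frame Ck_pdu_pdv openU, simp add: inner_pd)
  moreover have "pdu (\<lambda>q. n1 q \<bullet> pdv y q) p = pdu (\<lambda>q. - yv q * \<nu> q) p"
    by (rule pd_cong[OF openU p]) (intro Ck_inner Ck_frame Ck_pdu_pdv openU, simp add: inner_pd)
  moreover have "pdv n1 p \<bullet> pdu y p - pdu n1 p \<bullet> pdv y p = J p * (\<gamma>\<^sub>2 p * \<nu> p + \<mu> p * \<beta>\<^sub>2 p)"
    unfolding pdu_dD[OF p, of y] pdv_dD[OF p, of y] pdu_dD[OF p, of n1] pdv_dD[OF p, of n1] structure_eqs[OF p] J_def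
    by (simp add: frame[OF p] inner_add_left inner_add_right inner_diff_left inner_diff_right algebra_simps)
  ultimately show ?thesis
    using mixed_partials_inner[OF openU Ck_frame(3,4) p] yu_yv_curl[OF p] by algebra
qed

section \<open>The integrating factor of the second coframe form\<close>

definition M where "M p = (\<mu> p)^2 - (\<nu> p)^2"
definition g where "g p = (M p * M p) powr (1 / 8)"

lemma M_nonzero: "p \<in> U \<Longrightarrow> M p \<noteq> 0"
  using \<mu>\<nu> by (simp add: M_def)

lemma M_sq_pos: "p \<in> U \<Longrightarrow> M p * M p > 0"
  using M_nonzero[of p] by (simp flip: power2_eq_square)

lemma Ck_M: "Ck k U M"
  unfolding M_def power2_eq_square by (intro Ck_mult Ck_diff Ck_\<mu> Ck_\<nu>)

lemma Ck_g: "Ck k U g"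
  unfolding g_def by (rule Ck_powr[OF M_sq_pos Ck_mult[OF Ck_M Ck_M]])

lemma g_pos: "p \<in> U \<Longrightarrow> g p > 0"
  using M_nonzero[of p] by (simp add: g_def)

lemma g_sq:
  assumes "p \<in> U"
  shows "g p * g p = sqrt \<bar>M p\<bar>"
proof -
  have "g p * g p = (M p * M p) powr (1 / 4)"
    by (simp add: g_def flip: powr_add)
  also have "\<dots> = ((M p * M p) powr (1 / 2)) powr (1 / 2)"
    by (subst powr_powr) simp
  also have "\<dots> = sqrt (sqrt (M p * M p))"
    by (simp add: powr_half_sqrt)
  finally show ?thesis by simp
qed

text \<open>Up to the factor \<open>- J\<close> the left side is the derivative of \<open>g\<close>
  along \<open>x\<close>. The Codazzi equations give \<open>4 \<gamma>\<^sub>2 M\<close> for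
  \<open>M\<close>, and the fourth root removes the 4.\<close>

lemma g_deriv:
  assumes p: "p \<in> U"
  shows "yu p * pdv g p - yv p * pdu g p = - J p * \<gamma>\<^sub>2 p * g p"
proof -
  have hp: "has_partials f (pdu f p) (pdv f p) p" if "Ck (Suc 0) U f" for f :: "param \<Rightarrow> real"
    by (rule Ck_has_partials[OF that p])
  let ?Mu = "2 * (\<mu> p * pdu \<mu> p - \<nu> p * pdu \<nu> p)" and ?Mv = "2 * (\<mu> p * pdv \<mu> p - \<nu> p * pdv \<nu> p)"
  note h\<mu> = hp[OF Ck_\<mu>] and h\<nu> = hp[OF Ck_\<nu>]
  have M: "has_partials M ?Mu ?Mv p"
    using has_partials_add[OF has_partials_mult[OF h\<mu> h\<mu>]
        has_partials_linear[OF bounded_linear_minus[OF bounded_linear_ident] has_partials_mult[OF h\<nu> h\<nu>]]]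
    by (simp add: M_def[abs_def] power2_eq_square algebra_simps)
  \<comment> \<open>This and the next identity turn the chain rule factor into
    \<open>g / (4 * M)\<close>, which is valid for either sign of \<open>M\<close>.\<close>
  have g7: "(M p * M p) powr (1 / 8 - 1) = g p / (M p * M p)"
    unfolding g_def powr_diff using M_sq_pos[OF p] by simp
  have g8: "1 / 8 * (g p / (M p * M p)) * (a * M p + M p * a) = g p / (4 * M p) * a" for a
    using M_nonzero[OF p] by (simp add: field_simps)
  have "has_partials g (g p / (4 * M p) * ?Mu) (g p / (4 * M p) * ?Mv) p"
    using has_partials_powr[OF has_partials_mult[OF M M] M_sq_pos[OF p], of "1 / 8"]
    unfolding g7 g8 g_def[abs_def, symmetric] .
  then have gu: "pdu g p = g p / (4 * M p) * ?Mu" and gv: "pdv g p = g p / (4 * M p) * ?Mv"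
    by (rule has_partials_pdu has_partials_pdv)+
  have "yu p * ?Mv - yv p * ?Mu = 2 * \<mu> p * (yu p * pdv \<mu> p - yv p * pdu \<mu> p) - 2 * \<nu> p * (yu p * pdv \<nu> p - yv p * pdu \<nu> p)"
    by (simp add: algebra_simps)
  also have "\<dots> = - J p * \<gamma>\<^sub>2 p * (4 * M p)"
    unfolding codazzi_\<mu>[OF p] codazzi_\<nu>[OF p] M_def by (simp add: algebra_simps power2_eq_square)
  finally have "g p / (4 * M p) * (yu p * ?Mv - yv p * ?Mu) = g p / (4 * M p) * (- J p * \<gamma>\<^sub>2 p * (4 * M p))"
    by simp
  also have "\<dots> = - J p * \<gamma>\<^sub>2 p * g p" using M_nonzero[OF p] by simp
  finally show ?thesis unfolding gu gv by (simp add: algebra_simps)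
qed

lemma gyu_gyv_closed:
  assumes p: "p \<in> U"
  shows "pdv (\<lambda>q. g q * yu q) p = pdu (\<lambda>q. g q * yv q) p"
proof -
  have "pdv (\<lambda>q. g q * yu q) p = pdv g p * yu p + g p * pdv yu p"
    "pdu (\<lambda>q. g q * yv q) p = pdu g p * yv p + g p * pdu yv p"
    by (rule pd_mult[OF _ _ p], (rule Ck_coeffs Ck_g)+)+
  then show ?thesis using g_deriv[OF p] yu_yv_curl[OF p] by algebra
qed

section \<open>Potentials of the coframe as new coordinates\<close>

lemma closed_form_local_potential:
  fixes P Q :: "param \<Rightarrow> real"
  assumes "\<And>k. Ck k U P" "\<And>k. Ck k U Q" "\<And>p. p \<in> U \<Longrightarrow> pdv P p = pdu Q p" "{a..b} \<times> {c..d} \<subseteq> U"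
  obtains f where "\<And>q. q \<in> {a<..<b} \<times> {c<..<d} \<Longrightarrow> has_partials f (P q) (Q q) q"
proof (rule closed_form_potential[OF openU assms(4)])
  show "has_partials P (pdu P q) (pdu Q q) q" if "q \<in> U" for q
    using Ck_has_partials[OF assms(1) that] assms(3)[OF that] by simp
  show "has_partials Q (pdu Q q) (pdv Q q) q" if "q \<in> U" for q
    using Ck_has_partials[OF assms(2) that] .
  show "continuous_on U (pdu Q)"
    by (rule Ck_continuous_on[OF Ck_pdu_pdv(1)[OF openU assms(2)[of "Suc 0"]]])
qed (rule that)

lemma canonical_parameters:
  assumes "p0 \<in> U"
  obtains V W \<phi> where "p0 \<in> V" "V \<subseteq> U" "diffeo_pl W V \<phi>"
    "\<And>q. q \<in> W \<Longrightarrow> has_partials (z \<circ> \<phi>) (x (\<phi> q)) ((1 / g (\<phi> q)) *\<^sub>R y (\<phi> q)) q"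
proof -
  obtain a b c d where ab: "a < fst p0" "fst p0 < b" "c < snd p0" "snd p0 < d"
    and sub: "{a..b} \<times> {c..d} \<subseteq> U"
    using open_contains_rectangle[OF openU assms] by metis
  let ?S = "{a<..<b} \<times> {c<..<d}"
  have S: "open ?S" "p0 \<in> ?S" "?S \<subseteq> U"
    using ab sub by (auto intro: open_Times simp: mem_Times_iff)
  obtain f1 where f1: "\<And>q. q \<in> ?S \<Longrightarrow> has_partials f1 (xu q) (xv q) q"
    using closed_form_local_potential[OF Ck_coeffs(1,2) xu_xv_closed sub] by metis
  have Ckg: "Ck k U (\<lambda>q. g q * yu q)" "Ck k U (\<lambda>q. g q * yv q)" for k
    by (intro Ck_mult Ck_g Ck_coeffs)+
  obtain f2 where f2: "\<And>q. q \<in> ?S \<Longrightarrow> has_partials f2 (g q * yu q) (g q * yv q) q"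
    using closed_form_local_potential[OF Ckg gyu_gyv_closed sub] by metis
  have CkS: "Ck k ?S xu" "Ck k ?S xv" "Ck k ?S (\<lambda>q. g q * yu q)" "Ck k ?S (\<lambda>q. g q * yv q)" for k
    by (rule Ck_subset[OF _ S(3)], rule Ck_coeffs Ckg)+
  \<comment> \<open>\<open>g * J\<close> is the Jacobian determinant of the two potentials.\<close>
  have D: "g p * J p = xu p * (g p * yv p) - xv p * (g p * yu p)" for p
    by (simp add: J_def algebra_simps)
  have D0: "g p * J p \<noteq> 0" if "p \<in> ?S" for p
    using J_nonzero[of p] g_pos[of p] S(3) that by auto
  obtain V W \<phi> where V: "p0 \<in> V" "V \<subseteq> ?S" "diffeo_pl W V \<phi>"
    and \<phi>: "\<And>q. q \<in> W \<Longrightarrow> has_partials \<phi>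
       (g (\<phi> q) * yv (\<phi> q) / (g (\<phi> q) * J (\<phi> q)), - (g (\<phi> q) * yu (\<phi> q)) / (g (\<phi> q) * J (\<phi> q)))
       (- xv (\<phi> q) / (g (\<phi> q) * J (\<phi> q)), xu (\<phi> q) / (g (\<phi> q) * J (\<phi> q))) q"
  proof (rule smooth_local_inverse[OF S(1,2) f1 f2 CkS D D0], assumption, assumption, assumption, goal_cases)
    case (1 V W \<phi>)
    show thesis by (rule 1(1)[OF 1(2,3,4,5)])
  qed
  show thesis
  proof (rule that[OF V(1) _ V(3)])
    show "V \<subseteq> U" using V(2) S(3) by blast
    fix q assume q: "q \<in> W"
    let ?p = "\<phi> q"
    have p: "?p \<in> U" using q V S(3) unfolding diffeo_pl_def by blast
    note J = J_nonzero[OF p] and g = g_pos[OF p]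
    \<comment> \<open>Components of the new coordinate fields in the basis \<open>x\<close>,
      \<open>y\<close>. They form the basis dual to the closed coframe, so scaling its second form
      by \<open>g\<close> leaves \<open>1 / g\<close> on \<open>y\<close>.\<close>
    have eqs: "g ?p * yv ?p / (g ?p * J ?p) * xu ?p + - (g ?p * yu ?p) / (g ?p * J ?p) * xv ?p = 1"
      "g ?p * yv ?p / (g ?p * J ?p) * yu ?p + - (g ?p * yu ?p) / (g ?p * J ?p) * yv ?p = 0"
      "- xv ?p / (g ?p * J ?p) * xu ?p + xu ?p / (g ?p * J ?p) * xv ?p = 0"
      "- xv ?p / (g ?p * J ?p) * yu ?p + xu ?p / (g ?p * J ?p) * yv ?p = 1 / g ?p"
      using J g by (simp_all add: divide_simps, simp_all add: J_def algebra_simps)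
    show "has_partials (z \<circ> \<phi>) (x ?p) ((1 / g ?p) *\<^sub>R y ?p) q"
      using has_partials_chain[OF Ck_has_partials[OF Ck_frame(1) p] \<phi>[OF q]]
      unfolding pdu_z[OF p] pdv_z[OF p] fst_conv snd_conv scaleR_combination eqs by simp
  qed
qed

end

theorem theorem7p3:
  fixes U :: "param set" and z :: "param \<Rightarrow> real ^ 4"
    and x y n1 n2 :: "param \<Rightarrow> real ^ 4"
    and \<nu> \<mu> \<gamma>\<^sub>1 \<gamma>\<^sub>2 \<beta>\<^sub>1 \<beta>\<^sub>2 :: "param \<Rightarrow> real"
  assumes mgt: "minimal_general_type U z x y n1 n2"
    and gf: "geometric_frame U z x y n1 n2 \<nu> \<mu> \<gamma>\<^sub>1 \<gamma>\<^sub>2 \<beta>\<^sub>1 \<beta>\<^sub>2"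
    and g1: "\<forall>p\<in>U. \<gamma>\<^sub>1 p = 0"
    and p0: "p0 \<in> U"
  shows "\<exists>V W \<phi>. p0 \<in> V \<and> V \<subseteq> U \<and> diffeo_pl W V \<phi> \<and>
           semi_canonical W (z \<circ> \<phi>) (x \<circ> \<phi>) (y \<circ> \<phi>) \<and>
           (\<forall>q\<in>W. EE (z \<circ> \<phi>) q = 1 \<and> FF (z \<circ> \<phi>) q = 0 \<and>
                   GG (z \<circ> \<phi>) q = 1 / sqrt \<bar>(\<mu> (\<phi> q))^2 - (\<nu> (\<phi> q))^2\<bar>)"
proof -
  interpret minimal_geometric_frame U z x y n1 n2 \<nu> \<mu> \<gamma>\<^sub>1 \<gamma>\<^sub>2 \<beta>\<^sub>1 \<beta>\<^sub>2
    using mgt gf g1 by unfold_locales (auto simp: minimal_general_type_def)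
  obtain V W \<phi> where V: "p0 \<in> V" "V \<subseteq> U" "diffeo_pl W V \<phi>"
    and hp: "\<And>q. q \<in> W \<Longrightarrow> has_partials (z \<circ> \<phi>) (x (\<phi> q)) ((1 / g (\<phi> q)) *\<^sub>R y (\<phi> q)) q"
    using canonical_parameters[OF p0] by metis
  have forms: "EE (z \<circ> \<phi>) q = 1 \<and> FF (z \<circ> \<phi>) q = 0 \<and> GG (z \<circ> \<phi>) q = 1 / (g (\<phi> q) * g (\<phi> q))"
    and fields: "x (\<phi> q) = (1 / sqrt (EE (z \<circ> \<phi>) q)) *\<^sub>R pdu (z \<circ> \<phi>) q"
      "y (\<phi> q) = (1 / sqrt (GG (z \<circ> \<phi>) q)) *\<^sub>R pdv (z \<circ> \<phi>) q"
    and p: "\<phi> q \<in> U" if "q \<in> W" for q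
  proof -
    show p: "\<phi> q \<in> U" using that V by (auto simp: diffeo_pl_def)
    note pd = has_partials_pdu(2)[OF hp[OF that]] has_partials_pdv(2)[OF hp[OF that]]
    show *: "EE (z \<circ> \<phi>) q = 1 \<and> FF (z \<circ> \<phi>) q = 0 \<and> GG (z \<circ> \<phi>) q = 1 / (g (\<phi> q) * g (\<phi> q))"
      unfolding EE_def FF_def GG_def pd by (simp add: frame[OF p])
    show "x (\<phi> q) = (1 / sqrt (EE (z \<circ> \<phi>) q)) *\<^sub>R pdu (z \<circ> \<phi>) q"
      "y (\<phi> q) = (1 / sqrt (GG (z \<circ> \<phi>) q)) *\<^sub>R pdv (z \<circ> \<phi>) q"
      \<comment> \<open>Positivity of \<open>g\<close> gives \<open>sqrt G = 1 / g\<close>; the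
        normalized second field is then \<open>y\<close> and not \<open>- y\<close>.\<close>
      using * g_pos[OF p] by (simp_all add: pd real_sqrt_divide)
  qed
  have "semi_canonical W (z \<circ> \<phi>) (x \<circ> \<phi>) (y \<circ> \<phi>)"
    unfolding semi_canonical_def using forms fields by simp
  moreover have "\<forall>q\<in>W. EE (z \<circ> \<phi>) q = 1 \<and> FF (z \<circ> \<phi>) q = 0 \<and>
      GG (z \<circ> \<phi>) q = 1 / sqrt \<bar>(\<mu> (\<phi> q))^2 - (\<nu> (\<phi> q))^2\<bar>"
    using forms g_sq[OF p] by (simp add: M_def)
  ultimately show ?thesis using V by blast
qed

end
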